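(* Let $p,q\in\mathbb{R}[x]$ be such that $\mathscr{W}(p)$ and $\mathscr{W}(q)$ have nonnegative, interlacing symmetric decompositions. Then $\mathscr{W}(pq)$ also has a nonnegative, interlacing symmetric decomposition.
   Context: For a polynomial $p\in\mathbb{R}[x]$ of degree $d$, $\mathscr{W}(p)$ denotes the polynomial of degree at most $d$ defined by $\sum_{j\ge0}p(j)x^j=\mathscr{W}(p)(x)/(1-x)^{d+1}$. For a polynomial $a$ of degree at most $s$ let $\mathcal{I}_s(a)(x)=x^sa(1/x)$. Every polynomial $h$ of degree at most $d$ can be written uniquely as $h=a+x\,b$ with $\mathcal{I}_d(a)=a$ and $\mathcal{I}_{d-1}(b)=b$; $(a,b)$ is the symmetric decomposition of $h$ (with respect to $d$); for $\mathscr{W}(p)$ it is taken with respect to $d=\deg p$. It is nonnegative if $a,b$ have only nonnegative coefficients. For real-rooted polynomials $a,b$ with zeros $s_k\le\cdots\le s_1$ and $t_m\le\cdots\le t_1$, we say $b$ interlaces $a$, written $b\preceq a$, if $\cdots\le t_2\le s_2\le t_1\le s_1$. The symmetric decomposition $(a,b)$ is interlacing if $a$ and $b$ are real-rooted and $b\preceq a$. *)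

theory Defs
  imports
    "HOL-Analysis.Analysis"
    "HOL-Computational_Algebra.Computational_Algebra"
begin

definition is_W_poly :: "real poly \<Rightarrow> real poly \<Rightarrow> bool" where
  "is_W_poly p w \<longleftrightarrow>
     degree w \<le> degree p \<and>
     Abs_fps (\<lambda>j. poly p (of_nat j)) = fps_of_poly w / (1 - fps_X) ^ (degree p + 1)"

definition W_poly :: "real poly \<Rightarrow> real poly" where
  "W_poly p = (THE w. is_W_poly p w)"

lemma W_poly_aux_exists:
  "degree p \<le> d \<Longrightarrow> \<exists>w. degree w \<le> d \<and>
     Abs_fps (\<lambda>j. poly (p :: real poly) (of_nat j)) * (1 - fps_X) ^ (d + 1) = fps_of_poly w"
proof (induction d arbitrary: p)
  case 0
  then obtain c where p: "p = [:c:]" by (metis degree_eq_zeroE le_zero_eq)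
  have "Abs_fps (\<lambda>j. poly p (of_nat j)) * (1 - fps_X) = fps_of_poly [:c:]"
    by (rule fps_ext) (auto simp: p algebra_simps fps_of_poly_const)
  then show ?case by (intro exI[of _ "[:c:]"]) simp
next
  case (Suc d)
  define q where "q = p - pcompose p [:-1, 1:]"
  have "degree q \<le> d"
  proof (cases "degree p = 0")
    case True
    then obtain c where "p = [:c:]" by (metis degree_eq_zeroE)
    then show ?thesis by (simp add: q_def)
  next
    case False
    have "degree q < degree p"
    proof (rule degree_lessI)
      show "\<forall>k\<ge>degree p. coeff q k = 0"
      proof (intro allI impI)
        fix k assume k: "degree p \<le> k"
        have dc: "degree (pcompose p [:-1, 1:]) = degree p"
          by (simp add: degree_pcompose)
        have lc: "lead_coeff (pcompose p [:-1, 1:]) = lead_coeff p"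
          by (subst lead_coeff_comp) auto
        show "coeff q k = 0"
          using k dc lc unfolding q_def
          by (cases "k = degree p") (auto simp: coeff_eq_0)
      qed
      show "q \<noteq> 0 \<or> 0 < degree p" using False by simp
    qed
    with Suc.prems show ?thesis by linarith
  qed
  from Suc.IH[OF this] obtain w where w: "degree w \<le> d"
    "Abs_fps (\<lambda>j. poly q (of_nat j)) * (1 - fps_X) ^ (d + 1) = fps_of_poly w" by blast
  define c where "c = poly p 0 - poly q 0"
  have step: "Abs_fps (\<lambda>j. poly p (of_nat j)) * (1 - fps_X) =
      Abs_fps (\<lambda>j. poly q (of_nat j)) + fps_const c"
  proof (rule fps_ext)
    fix n show "(Abs_fps (\<lambda>j. poly p (of_nat j)) * (1 - fps_X)) $ n =
      (Abs_fps (\<lambda>j. poly q (of_nat j)) + fps_const c) $ n"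
      by (cases n) (auto simp: q_def c_def algebra_simps poly_pcompose)
  qed
  let ?w = "w + smult c ([:1, -1:] ^ (d + 1))"
  have X: "fps_of_poly [:1, -1:] = (1 - fps_X :: real fps)"
    by (simp add: fps_of_poly_pCons)
  have "Abs_fps (\<lambda>j. poly p (of_nat j)) * (1 - fps_X) ^ (Suc d + 1) =
      (Abs_fps (\<lambda>j. poly p (of_nat j)) * (1 - fps_X)) * (1 - fps_X) ^ (d + 1)"
    by (simp add: mult.assoc)
  also have "\<dots> = fps_of_poly w + fps_const c * (1 - fps_X) ^ (d + 1)"
    unfolding step by (simp only: distrib_right w)
  also have "\<dots> = fps_of_poly ?w"
    by (simp only: fps_of_poly_add fps_of_poly_smult fps_of_poly_power X)
  finally have "Abs_fps (\<lambda>j. poly p (of_nat j)) * (1 - fps_X) ^ (Suc d + 1) = fps_of_poly ?w" .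
  moreover have "degree ?w \<le> Suc d"
  proof (rule degree_add_le)
    show "degree w \<le> Suc d" using w by simp
    have "degree ([:1, -1 :: real:] ^ (d + 1)) \<le> degree [:1, -1 :: real:] * (d + 1)"
      by (rule degree_power_le)
    then show "degree (smult c ([:1, -1:] ^ (d + 1))) \<le> Suc d"
      using degree_smult_le[of c "[:1, -1:] ^ (d + 1)"] by simp
  qed
  ultimately show ?case by blast
qed

lemma is_W_poly_iff:
  "is_W_poly p w \<longleftrightarrow> degree w \<le> degree p \<and>
     Abs_fps (\<lambda>j. poly p (of_nat j)) * (1 - fps_X) ^ (degree p + 1) = fps_of_poly w"
proof -
  have u: "((1 - fps_X :: real fps) ^ (degree p + 1)) $ 0 \<noteq> 0"
    by (simp add: fps_power_zeroth)
  show ?thesis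
    unfolding is_W_poly_def fps_divide_unit[OF u]
    by (metis (no_types, lifting) inverse_mult_eq_1 inverse_mult_eq_1' mult.assoc mult.right_neutral u)
qed

lemma is_W_poly_ex1: "\<exists>!w. is_W_poly p w"
  using W_poly_aux_exists[of p "degree p"] unfolding is_W_poly_iff
  by (metis fps_of_poly_eq_iff order_refl)

lemma is_W_poly_W_poly: "is_W_poly p (W_poly p)"
  unfolding W_poly_def by (rule theI'[OF is_W_poly_ex1])

definition recip_poly :: "nat \<Rightarrow> real poly \<Rightarrow> real poly" where
  "recip_poly s a = (\<Sum>i\<le>s. monom (coeff a i) (s - i))"

lemma coeff_recip_poly:
  "coeff (recip_poly s a) k = (if k \<le> s then coeff a (s - k) else 0)"
proof -
  have "coeff (recip_poly s a) k = (\<Sum>i\<le>s. if s - i = k then coeff a i else 0)"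
    by (simp add: recip_poly_def coeff_sum)
  also have "\<dots> = (\<Sum>i\<le>s. if i = s - k \<and> k \<le> s then coeff a i else 0)"
    by (intro sum.cong) auto
  also have "\<dots> = (if k \<le> s then coeff a (s - k) else 0)"
    by (simp add: sum.delta)
  finally show ?thesis .
qed

lemma poly_recip_poly:
  assumes "degree a \<le> s" "x \<noteq> 0"
  shows "poly (recip_poly s a) x = x ^ s * poly a (1 / x)"
proof -
  have "poly a (1 / x) = (\<Sum>i\<le>s. coeff a i * (1 / x) ^ i)"
    unfolding poly_altdef using assms(1)
    by (intro sum.mono_neutral_left) (auto simp: coeff_eq_0)
  then show ?thesis
    using assms(2)
    by (auto simp: recip_poly_def poly_sum poly_monom sum_distrib_left power_diff
        power_one_over field_simps intro!: sum.cong)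
qed

text \<open>For \<open>d = 0\<close> the second component has degree at most \<open>-1\<close>, i.e. it is zero;
  this is what the disjunction in the definition expresses.\<close>

definition symmetric_decomposition ::
    "nat \<Rightarrow> real poly \<Rightarrow> real poly \<Rightarrow> real poly \<Rightarrow> bool" where
  "symmetric_decomposition d h a b \<longleftrightarrow>
     h = a + [:0, 1:] * b \<and>
     degree a \<le> d \<and> recip_poly d a = a \<and>
     (b = 0 \<or> degree b < d) \<and> recip_poly (d - 1) b = b"

lemma symmetric_decomposition_exists:
  assumes "degree h \<le> d"
  shows "\<exists>a b. symmetric_decomposition d h a b"
proof -
  define A where "A k = (\<Sum>i<k. coeff h i)" for k
  define B where "B k = (\<Sum>i<k. coeff h (d - i))" for k
  have flip: "A (d + 1) = A k + B (d + 1 - k)" if "k \<le> d + 1" for k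
  proof -
    have "B (d + 1 - k) = (\<Sum>i\<in>{k..<d + 1}. coeff h i)"
      unfolding B_def
      by (rule sum.reindex_bij_witness[of _ "\<lambda>i. d - i" "\<lambda>i. d - i"]) (use that in auto)
    moreover have "A (d + 1) = A k + (\<Sum>i\<in>{k..<d + 1}. coeff h i)"
      unfolding A_def lessThan_atLeast0
      by (rule sum.atLeastLessThan_concat[symmetric]) (use that in auto)
    ultimately show ?thesis by simp
  qed
  define a where "a = Poly (map (\<lambda>i. A (i + 1) - B i) [0..<d + 1])"
  define b where "b = Poly (map (\<lambda>i. B (i + 1) - A (i + 1)) [0..<d])"
  have ca: "coeff a i = (if i \<le> d then A (i + 1) - B i else 0)" for i
    by (auto simp del: upt_Suc simp: a_def coeff_Poly_eq nth_default_def)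
  have cb: "coeff b i = (if i < d then B (i + 1) - A (i + 1) else 0)" for i
    by (auto simp: b_def coeff_Poly_eq nth_default_def)
  have AB: "A (d + 1) = B (d + 1)" using flip[of 0] by (simp add: A_def)
  have "h = a + [:0, 1:] * b"
  proof (rule poly_eqI)
    fix n
    show "coeff h n = coeff (a + [:0, 1:] * b) n"
    proof (cases n)
      case 0
      then show ?thesis by (simp add: ca A_def B_def)
    next
      case (Suc m)
      then show ?thesis using assms by (auto simp: ca cb A_def B_def coeff_eq_0)
    qed
  qed
  moreover have "degree a \<le> d" by (rule degree_le) (simp add: ca)
  moreover have "recip_poly d a = a"
  proof (rule poly_eqI)
    fix n
    show "coeff (recip_poly d a) n = coeff a n"
    proof (cases "n \<le> d")
      case True
      then show ?thesis
        using flip[of "n + 1"] flip[of "d - n + 1"] by (simp add: coeff_recip_poly ca)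
    qed (simp add: coeff_recip_poly ca)
  qed
  moreover have "b = 0 \<or> degree b < d"
    by (cases "d = 0") (auto simp: poly_eq_iff cb intro!: degree_lessI)
  moreover have "recip_poly (d - 1) b = b"
  proof (rule poly_eqI)
    fix n
    show "coeff (recip_poly (d - 1) b) n = coeff b n"
    proof (cases "n < d")
      case True
      then have "d - 1 - n + 1 = d - n" "d + 1 - (n + 1) = d - n" "d + 1 - (d - n) = n + 1"
        by auto
      moreover from this have "A (n + 1) + B (d - n) = A (d - n) + B (n + 1)"
        using flip[of "n + 1"] flip[of "d - n"] True by simp
      ultimately show ?thesis
        using True by (auto simp: coeff_recip_poly cb)
    qed (auto simp: coeff_recip_poly cb)
  qed
  ultimately show ?thesis unfolding symmetric_decomposition_def by blast
qed

lemma symmetric_decomposition_unique: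
  assumes "symmetric_decomposition d h a b" "symmetric_decomposition d h a' b'"
  shows "a = a' \<and> b = b'"
proof -
  define u where "u = a - a'"
  define v where "v = b - b'"
  have "a + [:0, 1:] * b = a' + [:0, 1:] * b'"
    using assms unfolding symmetric_decomposition_def by metis
  then have eq: "u + [:0, 1:] * v = 0"
    unfolding u_def v_def right_diff_distrib by (simp only: diff_add_eq add_diff_eq)
  have ra: "coeff u k = coeff u (d - k)" if "k \<le> d" for k
    using assms that coeff_recip_poly[of d a k] coeff_recip_poly[of d a' k]
    by (simp add: symmetric_decomposition_def u_def)
  have rb: "coeff v k = coeff v (d - 1 - k)" if "k < d" for k
    using assms that coeff_recip_poly[of "d - 1" b k] coeff_recip_poly[of "d - 1" b' k]
    by (auto simp: symmetric_decomposition_def v_def)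
  have v0: "coeff v k = 0" if "d \<le> k" for k
    using assms that by (auto simp: symmetric_decomposition_def v_def coeff_eq_0)
  have u0: "coeff u 0 = 0" using arg_cong[OF eq, of "\<lambda>r. coeff r 0"] by simp
  have uS: "coeff u (Suc k) = - coeff v k" for k
    using arg_cong[OF eq, of "\<lambda>r. coeff r (Suc k)"] by simp
  have "coeff u k = 0 \<and> coeff v k = 0" if "k < d" for k
    using that
  proof (induction k)
    case 0
    have "coeff v (d - 1) = - coeff u d" using uS[of "d - 1"] 0 by simp
    with 0 show ?case using ra[of 0] rb[of 0] u0 by simp
  next
    case (Suc k)
    have 1: "coeff u (Suc k) = 0" using uS[of k] Suc by simp
    have "coeff v (Suc k) = coeff v (d - 1 - Suc k)" using rb Suc.prems by blast
    also have "\<dots> = - coeff u (d - Suc k)"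
      using uS[of "d - 1 - Suc k"] Suc.prems by (simp add: Suc_diff_Suc)
    also have "\<dots> = 0" using ra[of "Suc k"] Suc.prems 1 by simp
    finally show ?case using 1 by simp
  qed
  with v0 have "v = 0" by (metis leading_coeff_0_iff not_less)
  with eq show ?thesis by (simp add: u_def v_def)
qed

definition nonneg_coeffs :: "real poly \<Rightarrow> bool" where
  "nonneg_coeffs a \<longleftrightarrow> (\<forall>i. 0 \<le> coeff a i)"

text \<open>The zero polynomial counts as real-rooted.\<close>

definition real_rooted :: "real poly \<Rightarrow> bool" where
  "real_rooted a \<longleftrightarrow>
     a = 0 \<or> (\<forall>z :: complex. poly (map_poly of_real a) z = 0 \<longrightarrow> z \<in> \<real>)"

definition zeros_desc :: "real poly \<Rightarrow> real list" where
  "zeros_desc a = rev (sorted_list_of_multiset (proots a))"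

text \<open>\<open>interlaces b a\<close> is \<open>b \<preceq> a\<close>; the largest zero belongs to \<open>a\<close>. The alternating chain of
  inequalities forces \<open>a\<close> to have as many zeros as \<open>b\<close> or exactly one more. By the usual
  convention the zero polynomial interlaces, and is interlaced by, every real-rooted
  polynomial; for instance the decomposition of a palindromic polynomial has \<open>b = 0\<close>.\<close>

definition interlaces :: "real poly \<Rightarrow> real poly \<Rightarrow> bool" where
  "interlaces b a \<longleftrightarrow> real_rooted a \<and> real_rooted b \<and>
     (a = 0 \<or> b = 0 \<or>
       (let s = zeros_desc a; t = zeros_desc b in
          (length s = length t \<or> length s = length t + 1) \<and>
          (\<forall>i < length t. t ! i \<le> s ! i) \<and>
          (\<forall>i < length t. i + 1 < length s \<longrightarrow> s ! (i + 1) \<le> t ! i)))"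

definition nonneg_interlacing_decomposition :: "nat \<Rightarrow> real poly \<Rightarrow> bool" where
  "nonneg_interlacing_decomposition d h \<longleftrightarrow>
     (\<exists>a b. symmetric_decomposition d h a b \<and>
            nonneg_coeffs a \<and> nonneg_coeffs b \<and> interlaces b a)"

end

theory Submission
  imports Defs
begin

text \<open>
  Write \<open>h = W(p) = a + x b\<close> and \<open>h* = I\<^sub>d(h) = a + b\<close>, and likewise \<open>k\<close>, \<open>k*\<close> for \<open>q\<close>. The
  symmetric decomposition of \<open>h\<close> is nonnegative and interlacing if and only if \<open>h\<close> has
  nonnegative coefficients and \<open>h* \<preceq> h\<close>: one direction is a computation with Hermite--Biehler,
  and for the other one \<open>(x - 1) b = h - h*\<close> and \<open>(x - 1) a = x h* - h\<close>, where \<open>h* \<preceq> h \<preceq> x h*\<close> and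
  \<open>1\<close> is the largest zero of both differences. It remains to see that the bilinear map \<open>\<Theta>\<close> with
  \<open>W(pq) = \<Theta>(W(p), W(q))\<close>, which commutes with taking reciprocals, preserves \<open>\<preceq>\<close>.

  If \<open>h* \<preceq> h \<preceq> x h*\<close>, then \<open>h(Y)/h*(Y)\<close> lies in the sector between \<open>1\<close> and \<open>Y\<close>. The value of
  \<open>\<Theta>(h, k)\<close> at \<open>y\<close> is a coefficient of a polynomial whose values are, up to elementary factors,
  \<open>h(Y) k(y/Y)\<close>. By Gauss--Lucas, \<open>\<Theta>(h, k)(y) / \<Theta>(h*, k*)(y)\<close> can therefore only be one of the
  values \<open>(h/h*)(Y) (k/k*)(y/Y)\<close> for \<open>Y\<close> in the closed upper half-plane, and these avoid the
  negative real axis if \<open>y\<close> is in the open upper half-plane. The same principle gives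
  \<open>\<Theta>(h*, k*) \<preceq> \<Theta>(h*, k) \<preceq> \<Theta>(h, k)\<close>, which bounds the argument of \<open>\<Theta>(h, k) / \<Theta>(h*, k*)\<close> by
  \<open>2\<pi>\<close>; by continuity it is in fact less than \<open>\<pi>\<close>.
\<close>

section \<open>Numerators of Hadamard products\<close>

lemma choose_mult_choose:
  fixes k m n :: nat
  assumes "k \<le> m"
  shows "(n choose m) * (m choose k) = (n choose k) * ((n - k) choose (m - k))"
  using assms by (cases "m \<le> n") (auto simp: choose_mult binomial_eq_0)

lemma sum_choose_mult_choose:
  fixes a b j n :: nat
  assumes "j \<le> n"
  shows "(\<Sum>k\<le>n. (a choose k) * (b choose (n - k)) * (k choose j)) =
    (a choose j) * ((a + b - j) choose (n - j))"
proof -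
  have "(\<Sum>k\<le>n. (a choose k) * (b choose (n - k)) * (k choose j)) =
      (\<Sum>k\<in>{j..n}. (b choose (n - k)) * ((a choose k) * (k choose j)))"
    by (rule sum.mono_neutral_cong_right) auto
  also have "\<dots> = (\<Sum>k\<in>{j..n}. (b choose (n - k)) * ((a choose j) * ((a - j) choose (k - j))))"
    by (intro sum.cong refl arg_cong2[where f = "(*)"] choose_mult_choose) simp
  also have "\<dots> = (\<Sum>k\<in>{j..n}. (a choose j) * (((a - j) choose (k - j)) * (b choose (n - k))))"
    by (simp only: mult_ac)
  also have "\<dots> = (\<Sum>k\<le>n - j. (a choose j) * (((a - j) choose k) * (b choose (n - j - k))))"
    by (rule sum.reindex_bij_witness[of _ "\<lambda>k. k + j" "\<lambda>k. k - j"]) (use assms in auto)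
  also have "\<dots> = (a choose j) * ((a - j + b) choose (n - j))"
    by (simp only: vandermonde flip: sum_distrib_left)
  also have "\<dots> = (a choose j) * ((a + b - j) choose (n - j))"
    by (cases "j \<le> a") simp_all
  finally show ?thesis .
qed

lemma Nanjundiah_identity:
  fixes m n x y a b :: nat
  assumes "a + b = m + n" and "m + y = x + a"
  shows "(\<Sum>k\<le>n. (a choose k) * (b choose (n - k)) * ((x + k) choose (m + n))) =
    (x choose m) * (y choose n)"
proof -
  have expand: "(x + k) choose (m + n) = (\<Sum>j\<le>n. (k choose j) * (x choose (m + n - j)))"
    if "k \<le> n" for k
  proof -
    have "(x + k) choose (m + n) = (\<Sum>j\<le>m + n. (k choose j) * (x choose (m + n - j)))"
      by (simp add: vandermonde add.commute)
    also have "\<dots> = (\<Sum>j\<le>n. (k choose j) * (x choose (m + n - j)))"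
      by (rule sum.mono_neutral_right) (use that in auto)
    finally show ?thesis .
  qed
  have absorb: "(x choose (m + n - j)) * ((m + n - j) choose (n - j)) =
      (x choose m) * ((x - m) choose (n - j))" if "j \<le> n" for j
    using choose_mult_choose[of m "m + n - j" x] binomial_symmetric[of "n - j" "m + n - j"] that
    by simp
  have "(\<Sum>k\<le>n. (a choose k) * (b choose (n - k)) * ((x + k) choose (m + n))) =
      (\<Sum>k\<le>n. \<Sum>j\<le>n. (x choose (m + n - j)) * ((a choose k) * (b choose (n - k)) * (k choose j)))"
    by (intro sum.cong) (simp_all add: expand sum_distrib_left mult_ac)
  also have "\<dots> = (\<Sum>j\<le>n. (x choose (m + n - j)) *
      (\<Sum>k\<le>n. (a choose k) * (b choose (n - k)) * (k choose j)))"
    by (subst sum.swap) (simp add: sum_distrib_left)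
  also have "\<dots> = (\<Sum>j\<le>n. (a choose j) * ((x choose (m + n - j)) * ((m + n - j) choose (n - j))))"
    by (intro sum.cong) (simp_all add: sum_choose_mult_choose assms)
  also have "\<dots> = (\<Sum>j\<le>n. (x choose m) * ((a choose j) * ((x - m) choose (n - j))))"
    by (intro sum.cong) (simp_all add: absorb mult_ac)
  also have "\<dots> = (x choose m) * ((a + (x - m)) choose n)"
    by (simp add: vandermonde flip: sum_distrib_left)
  also have "\<dots> = (x choose m) * (y choose n)"
  proof (cases "m \<le> x")
    case True
    then have "a + (x - m) = y" using assms by simp
    then show ?thesis by simp
  qed simp
  finally show ?thesis .
qed

definition numerator_seq :: "nat \<Rightarrow> real poly \<Rightarrow> nat \<Rightarrow> real" where
  "numerator_seq D w n = (\<Sum>m\<le>D. coeff w m * of_nat ((n + D - m) choose D))"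

lemma fps_of_poly_divide_one_minus_X_power:
  assumes "degree w \<le> D"
  shows "fps_of_poly w / (1 - fps_X) ^ (D + 1) = Abs_fps (numerator_seq D w)"
proof (rule fps_ext)
  fix n
  have inverse: "inverse ((1 - fps_X) ^ (D + 1)) = Abs_fps (\<lambda>k. of_nat ((D + k) choose k) :: real)"
    using one_minus_const_fps_X_neg_power'[of "D + 1" "1 :: real"] by simp
  have unit: "((1 - fps_X :: real fps) ^ (D + 1)) $ 0 \<noteq> 0"
    by (simp add: fps_power_zeroth)
  have "(fps_of_poly w / (1 - fps_X) ^ (D + 1)) $ n =
      (\<Sum>m = 0..n. coeff w m * of_nat ((D + (n - m)) choose (n - m)))"
    unfolding fps_divide_unit[OF unit] inverse by (simp add: fps_mult_nth)
  also have "\<dots> = (\<Sum>m\<le>n. coeff w m * of_nat ((n + D - m) choose D))"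
  proof (rule sum.cong)
    fix m assume "m \<in> {..n}"
    then have "(D + (n - m)) choose (n - m) = (n + D - m) choose D"
      using binomial_symmetric[of D "n + D - m"] by (simp add: add.commute)
    then show "coeff w m * of_nat ((D + (n - m)) choose (n - m)) =
        coeff w m * of_nat ((n + D - m) choose D)" by simp
  qed auto
  also have "\<dots> = numerator_seq D w n"
    unfolding numerator_seq_def
    by (rule sum.mono_neutral_cong) (use assms in \<open>auto simp: coeff_eq_0\<close>)
  finally show "(fps_of_poly w / (1 - fps_X) ^ (D + 1)) $ n = Abs_fps (numerator_seq D w) $ n"
    by simp
qed

lemma numerator_seq_inject:
  assumes "degree v \<le> D" and "degree w \<le> D" and "numerator_seq D v = numerator_seq D w"
  shows "v = w"
proof -
  have unit: "((1 - fps_X :: real fps) ^ (D + 1)) $ 0 \<noteq> 0"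
    by (simp add: fps_power_zeroth)
  have "fps_of_poly v / (1 - fps_X) ^ (D + 1) = fps_of_poly w / (1 - fps_X) ^ (D + 1)"
    using assms by (simp only: fps_of_poly_divide_one_minus_X_power)
  moreover have "inverse ((1 - fps_X :: real fps) ^ (D + 1)) \<noteq> 0"
    using unit by (simp only: fps_inverse_eq_0_iff not_False_eq_True)
  ultimately have "fps_of_poly v = fps_of_poly w"
    unfolding fps_divide_unit[OF unit] by (metis mult_right_cancel)
  then show ?thesis by (simp add: fps_of_poly_eq_iff)
qed

lemma is_W_poly_iff_numerator_seq:
  "is_W_poly p w \<longleftrightarrow>
    degree w \<le> degree p \<and> (\<forall>n. poly p (of_nat n) = numerator_seq (degree p) w n)"
  unfolding is_W_poly_def
  by (metis (no_types, lifting) fps_of_poly_divide_one_minus_X_power fps_eq_iff fps_nth_Abs_fps)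

lemma degree_W_poly: "degree (W_poly p) \<le> degree p"
  using is_W_poly_W_poly[of p] by (simp add: is_W_poly_iff_numerator_seq)

lemma poly_of_nat_eq_numerator_seq: "poly p (of_nat n) = numerator_seq (degree p) (W_poly p) n"
  using is_W_poly_W_poly[of p] by (simp add: is_W_poly_iff_numerator_seq)

lemma W_poly_eqI:
  assumes "degree w \<le> degree p" and "\<And>n. poly p (of_nat n) = numerator_seq (degree p) w n"
  shows "W_poly p = w"
  using assms is_W_poly_W_poly is_W_poly_ex1 is_W_poly_iff_numerator_seq by blast

lemma W_poly_eq_0_iff: "W_poly p = 0 \<longleftrightarrow> p = 0"
proof
  assume "W_poly p = 0"
  then have "poly p (of_nat n) = 0" for n
    by (simp add: poly_of_nat_eq_numerator_seq numerator_seq_def)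
  then have "range real \<subseteq> {x. poly p x = 0}" by auto
  moreover have "infinite (range real)" by (simp add: finite_image_iff inj_on_def)
  ultimately show "p = 0" using poly_roots_finite finite_subset by blast
qed (simp add: W_poly_eqI numerator_seq_def)

text \<open>The numerator of the Hadamard product of \<open>x\<^bsup>i\<^esup> / (1 - x)\<^bsup>d + 1\<^esup>\<close> and
  \<open>x\<^bsup>j\<^esup> / (1 - x)\<^bsup>e + 1\<^esup>\<close>, as given by Nanjundiah's identity. The subtractions do not truncate for
  \<open>i \<le> d\<close> and \<open>j \<le> e\<close>.\<close>

definition hadamard_term :: "nat \<Rightarrow> nat \<Rightarrow> nat \<Rightarrow> nat \<Rightarrow> real poly" where
  "hadamard_term d e i j =
    (\<Sum>l\<le>e. monom (of_nat (((e + i - j) choose (e - l)) * ((d + j - i) choose l))) (i + l))"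

definition hadamard_num :: "nat \<Rightarrow> nat \<Rightarrow> real poly \<Rightarrow> real poly \<Rightarrow> real poly" where
  "hadamard_num d e h k =
    (\<Sum>i\<le>d. \<Sum>j\<le>e. smult (coeff h i * coeff k j) (hadamard_term d e i j))"

lemma degree_hadamard_num: "degree (hadamard_num d e h k) \<le> d + e"
  unfolding hadamard_num_def hadamard_term_def
  by (intro degree_sum_le order.trans[OF degree_smult_le] order.trans[OF degree_monom_le]) auto

lemma nonneg_coeffs_hadamard_num:
  "nonneg_coeffs h \<Longrightarrow> nonneg_coeffs k \<Longrightarrow> nonneg_coeffs (hadamard_num d e h k)"
  unfolding nonneg_coeffs_def hadamard_num_def hadamard_term_def coeff_sum coeff_smult coeff_monom
  by (intro allI sum_nonneg mult_nonneg_nonneg) auto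

lemma numerator_seq_smult: "numerator_seq D (smult c w) n = c * numerator_seq D w n"
  by (simp add: numerator_seq_def sum_distrib_left mult_ac)

lemma numerator_seq_sum: "numerator_seq D (\<Sum>i\<in>A. f i) n = (\<Sum>i\<in>A. numerator_seq D (f i) n)"
  unfolding numerator_seq_def coeff_sum sum_distrib_right by (rule sum.swap)

lemma numerator_seq_monom:
  "m \<le> D \<Longrightarrow> numerator_seq D (monom c m) n = c * of_nat ((n + D - m) choose D)"
  by (simp add: numerator_seq_def if_distrib[of "\<lambda>x. x * _"] cong: if_cong)

lemma numerator_seq_hadamard_term:
  assumes "i \<le> d" and "j \<le> e"
  shows "numerator_seq (d + e) (hadamard_term d e i j) n =
    of_nat ((n + d - i) choose d) * of_nat ((n + e - j) choose e)"
proof -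
  have "numerator_seq (d + e) (hadamard_term d e i j) n =
      of_nat (\<Sum>l\<le>e. ((e + i - j) choose (e - l)) * ((d + j - i) choose l) *
        ((n + (d + e) - (i + l)) choose (d + e)))"
    using assms unfolding hadamard_term_def numerator_seq_sum
    by (simp add: numerator_seq_monom add.assoc)
  also have "(\<Sum>l\<le>e. ((e + i - j) choose (e - l)) * ((d + j - i) choose l) *
        ((n + (d + e) - (i + l)) choose (d + e))) =
      (\<Sum>l\<le>e. ((e + i - j) choose l) * ((d + j - i) choose (e - l)) *
        (((n + d - i) + l) choose (d + e)))"
    by (rule sum.reindex_bij_witness[of _ "\<lambda>l. e - l" "\<lambda>l. e - l"])
      (use assms in \<open>auto simp: add.assoc\<close>)
  also have "\<dots> = ((n + d - i) choose d) * ((n + e - j) choose e)"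
    by (rule Nanjundiah_identity) (use assms in auto)
  finally show ?thesis by simp
qed

lemma numerator_seq_hadamard_num:
  "numerator_seq (d + e) (hadamard_num d e h k) n = numerator_seq d h n * numerator_seq e k n"
proof -
  have "numerator_seq (d + e) (hadamard_num d e h k) n =
      (\<Sum>i\<le>d. \<Sum>j\<le>e. coeff h i * coeff k j *
        (of_nat ((n + d - i) choose d) * of_nat ((n + e - j) choose e)))"
    unfolding hadamard_num_def numerator_seq_sum numerator_seq_smult
    by (intro sum.cong) (simp_all add: numerator_seq_hadamard_term)
  then show ?thesis by (simp add: numerator_seq_def sum_product mult_ac)
qed

lemma W_poly_mult:
  assumes "p \<noteq> 0" and "q \<noteq> 0"
  shows "W_poly (p * q) = hadamard_num (degree p) (degree q) (W_poly p) (W_poly q)"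
proof (rule W_poly_eqI)
  show "degree (hadamard_num (degree p) (degree q) (W_poly p) (W_poly q)) \<le> degree (p * q)"
    using assms by (simp add: degree_mult_eq degree_hadamard_num)
  show "poly (p * q) (of_nat n) = numerator_seq (degree (p * q))
      (hadamard_num (degree p) (degree q) (W_poly p) (W_poly q)) n" for n
    unfolding degree_mult_eq[OF assms] numerator_seq_hadamard_num poly_mult
    by (simp only: poly_of_nat_eq_numerator_seq)
qed

lemma hadamard_num_commute: "hadamard_num d e h k = hadamard_num e d k h"
proof (rule numerator_seq_inject)
  show "degree (hadamard_num d e h k) \<le> d + e" "degree (hadamard_num e d k h) \<le> d + e"
    using degree_hadamard_num[of d e] degree_hadamard_num[of e d] by (simp_all add: add.commute)
  show "numerator_seq (d + e) (hadamard_num d e h k) =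
      numerator_seq (d + e) (hadamard_num e d k h)"
    using numerator_seq_hadamard_num[of e d k h]
    by (auto simp: numerator_seq_hadamard_num add.commute mult.commute)
qed

lemma recip_poly_add: "recip_poly s (a + b) = recip_poly s a + recip_poly s b"
  by (simp add: poly_eq_iff coeff_recip_poly)

lemma recip_poly_smult: "recip_poly s (smult c a) = smult c (recip_poly s a)"
  by (simp add: poly_eq_iff coeff_recip_poly)

lemma recip_poly_sum: "recip_poly s (\<Sum>i\<in>A. f i) = (\<Sum>i\<in>A. recip_poly s (f i))"
  by (simp add: poly_eq_iff coeff_recip_poly coeff_sum)

lemma recip_poly_monom: "m \<le> s \<Longrightarrow> recip_poly s (monom c m) = monom c (s - m)"
  by (auto simp: poly_eq_iff coeff_recip_poly)

lemma degree_recip_poly: "degree (recip_poly s a) \<le> s"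
  by (rule degree_le) (simp add: coeff_recip_poly)

lemma recip_poly_hadamard_term:
  assumes "i \<le> d" and "j \<le> e"
  shows "recip_poly (d + e) (hadamard_term d e i j) = hadamard_term d e (d - i) (e - j)"
proof -
  have "recip_poly (d + e) (hadamard_term d e i j) =
      (\<Sum>l\<le>e. monom (of_nat (((e + i - j) choose (e - l)) * ((d + j - i) choose l)))
        (d + e - (i + l)))"
    unfolding hadamard_term_def recip_poly_sum
    by (intro sum.cong recip_poly_monom) (use assms in auto)
  also have "\<dots> = (\<Sum>l\<le>e. monom (of_nat (((d + j - i) choose (e - l)) * ((e + i - j) choose l)))
        (d - i + l))"
    by (rule sum.reindex_bij_witness[of _ "\<lambda>l. e - l" "\<lambda>l. e - l"])
      (use assms in \<open>auto simp: mult.commute\<close>)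
  also have "\<dots> = hadamard_term d e (d - i) (e - j)"
  proof -
    have "e + (d - i) - (e - j) = d + j - i" "d + (e - j) - (d - i) = e + i - j"
      using assms by auto
    then show ?thesis by (simp only: hadamard_term_def)
  qed
  finally show ?thesis .
qed

lemma recip_poly_hadamard_num:
  "recip_poly (d + e) (hadamard_num d e h k) = hadamard_num d e (recip_poly d h) (recip_poly e k)"
proof -
  have "recip_poly (d + e) (hadamard_num d e h k) =
      (\<Sum>i\<le>d. \<Sum>j\<le>e. smult (coeff h i * coeff k j) (hadamard_term d e (d - i) (e - j)))"
    unfolding hadamard_num_def recip_poly_sum recip_poly_smult
    by (intro sum.cong) (simp_all add: recip_poly_hadamard_term)
  also have "\<dots> = (\<Sum>i\<le>d. \<Sum>j\<le>e. smult (coeff h (d - i) * coeff k (e - j)) (hadamard_term d e i j))"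
    by (rule sum.reindex_bij_witness[of _ "\<lambda>i. d - i" "\<lambda>i. d - i"];
        (rule sum.reindex_bij_witness[of _ "\<lambda>j. e - j" "\<lambda>j. e - j"])?) auto
  finally show ?thesis by (simp add: hadamard_num_def coeff_recip_poly)
qed

section \<open>Zeros in half-planes\<close>

lemma poly_pderiv_prod_linear:
  fixes r :: "'i \<Rightarrow> 'a :: field"
  assumes "finite A" and "\<And>i. i \<in> A \<Longrightarrow> s \<noteq> r i"
  shows "poly (pderiv (\<Prod>i\<in>A. [:- r i, 1:])) s =
    poly (\<Prod>i\<in>A. [:- r i, 1:]) s * (\<Sum>i\<in>A. 1 / (s - r i))"
  using assms
proof (induction A rule: finite_induct)
  case empty
  show ?case by (simp add: pderiv_1)
next
  case (insert i A)
  let ?P = "\<Prod>i\<in>A. [:- r i, 1:]"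
  have "s - r i \<noteq> 0" using insert.prems by simp
  have "poly (pderiv ([:- r i, 1:] * ?P)) s = (s - r i) * poly (pderiv ?P) s + poly ?P s"
    unfolding pderiv_mult poly_add poly_mult by (simp add: pderiv_pCons)
  also have "\<dots> = (s - r i) * poly ?P s * (1 / (s - r i) + (\<Sum>i\<in>A. 1 / (s - r i)))"
    using insert \<open>s - r i \<noteq> 0\<close> by (simp add: distrib_left)
  finally show ?case
    using insert.hyps by (simp add: left_diff_distrib)
qed

lemma Gauss_Lucas_halfplane:
  fixes K :: "complex poly"
  assumes roots: "\<And>s. poly K s = 0 \<Longrightarrow> Im (c * s) < 0"
    and "degree K > 0" and "Im (c * s) \<ge> 0"
  shows "poly (pderiv K) s \<noteq> 0"
proof -
  obtain r where K: "smult (lead_coeff K) (\<Prod>i<degree K. [:- r i, 1:]) = K"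
    by (rule complex_poly_decompose')
  let ?P = "\<Prod>i<degree K. [:- r i, 1:]" and ?S = "\<Sum>i<degree K. 1 / (s - r i)"
  have pos: "Im (c * (s - r i)) > 0" if "i < degree K" for i
  proof -
    have "poly ?P (r i) = 0"
      using that by (auto simp: poly_prod prod_zero_iff)
    then have "poly K (r i) = 0" by (subst K[symmetric]) simp
    then show ?thesis using roots[of "r i"] assms(3) by (simp add: right_diff_distrib)
  qed
  have "Im (?S / c) = (\<Sum>i<degree K. Im (1 / (c * (s - r i))))"
    by (simp add: sum_divide_distrib mult.commute)
  also have "\<dots> < (\<Sum>i<degree K. 0)"
    using assms(2) pos by (intro sum_strict_mono)
      (fastforce simp: Im_complex_div_lt_0 algebra_simps)+
  finally have "?S \<noteq> 0" by auto
  moreover have "poly K s \<noteq> 0" using roots assms(3) by fastforce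
  moreover have "poly (pderiv K) s = poly K s * ?S"
  proof -
    have "poly (pderiv ?P) s = poly ?P s * ?S"
      using pos by (intro poly_pderiv_prod_linear) force+
    then have "poly (pderiv (smult (lead_coeff K) ?P)) s = poly (smult (lead_coeff K) ?P) s * ?S"
      by (simp add: pderiv_smult)
    then show ?thesis by (simp only: K)
  qed
  ultimately show ?thesis by simp
qed

lemma coeff_nonzero_of_roots_halfplane:
  fixes K :: "complex poly"
  assumes "\<And>s. poly K s = 0 \<Longrightarrow> Im (c * s) < 0" and "K \<noteq> 0" and "m \<le> degree K"
  shows "coeff K m \<noteq> 0"
  using assms
proof (induction m arbitrary: K)
  case 0
  show ?case using 0(1)[of 0] by (auto simp: poly_0_coeff_0)
next
  case (Suc m)
  have "coeff (pderiv K) m \<noteq> 0"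
  proof (rule Suc.IH)
    show "Im (c * s) < 0" if "poly (pderiv K) s = 0" for s
      using Gauss_Lucas_halfplane[of K c s] Suc.prems that by force
    show "pderiv K \<noteq> 0" using Suc.prems by (auto simp: pderiv_eq_0_iff)
    show "m \<le> degree (pderiv K)" using Suc.prems by (simp add: degree_pderiv)
  qed
  then show ?case by (auto simp: coeff_pderiv)
qed

section \<open>Real polynomials at complex points\<close>

definition ceval :: "real poly \<Rightarrow> complex \<Rightarrow> complex" where
  "ceval a z = poly (map_poly of_real a) z"

lemma ceval_0 [simp]: "ceval 0 z = 0"
  by (simp add: ceval_def)

lemma ceval_pCons [simp]: "ceval (pCons c a) z = of_real c + z * ceval a z"
  by (simp add: ceval_def map_poly_pCons)

lemma ceval_1 [simp]: "ceval 1 z = 1"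
  by (simp add: one_pCons)

lemma ceval_add [simp]: "ceval (a + b) z = ceval a z + ceval b z"
  by (induction a b rule: poly_induct2) (simp_all add: algebra_simps)

lemma ceval_smult [simp]: "ceval (smult c a) z = of_real c * ceval a z"
  by (induction a) (simp_all add: algebra_simps)

lemma ceval_minus [simp]: "ceval (- a) z = - ceval a z"
  by (induction a) simp_all

lemma ceval_diff [simp]: "ceval (a - b) z = ceval a z - ceval b z"
  using ceval_add[of a "- b" z] by simp

lemma ceval_mult [simp]: "ceval (a * b) z = ceval a z * ceval b z"
  by (induction a) (simp_all add: algebra_simps)

lemma ceval_sum [simp]: "ceval (\<Sum>i\<in>A. f i) z = (\<Sum>i\<in>A. ceval (f i) z)"
  by (induction A rule: infinite_finite_induct) simp_all

lemma ceval_monom [simp]: "ceval (monom c n) z = of_real c * z ^ n"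
  by (simp add: ceval_def map_poly_monom poly_monom)

lemma ceval_of_real: "ceval a (of_real x) = of_real (poly a x)"
  by (induction a) simp_all

lemma ceval_cnj: "ceval a (cnj z) = cnj (ceval a z)"
  by (induction a) simp_all

lemma ceval_altdef:
  assumes "degree a \<le> d"
  shows "ceval a z = (\<Sum>i\<le>d. of_real (coeff a i) * z ^ i)"
  using arg_cong[OF poly_as_sum_of_monoms'[OF assms], of "\<lambda>a. ceval a z"] by simp

section \<open>Hadamard products as residues\<close>

text \<open>The Hadamard product of \<open>h(x) / (1 - x)\<^bsup>d + 1\<^esup>\<close> and \<open>k(x) / (1 - x)\<^bsup>e + 1\<^esup>\<close> at \<open>y\<close> is the
  residue of \<open>h(Y) k(y / Y) / ((1 - Y)\<^bsup>d + 1\<^esup> (1 - y / Y)\<^bsup>e + 1\<^esup> Y)\<close> at \<open>Y = y\<close>. Substituting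
  \<open>Y = (y + s) / (1 + s)\<close> turns \<open>(1 - y)\<^bsup>d + e + 1\<^esup>\<close> times this residue into the coefficient of
  \<open>s\<^bsup>e\<^esup>\<close> in \<open>(1 + s)\<^bsup>d\<^esup> (y + s)\<^bsup>e\<^esup> h(Y) k(y / Y)\<close>.\<close>

definition residue_term :: "nat \<Rightarrow> nat \<Rightarrow> complex \<Rightarrow> nat \<Rightarrow> nat \<Rightarrow> complex poly" where
  "residue_term d e y i j = smult (y ^ j) ([:y, 1:] ^ (e + i - j) * [:1, 1:] ^ (d + j - i))"

definition residue_poly ::
    "nat \<Rightarrow> nat \<Rightarrow> real poly \<Rightarrow> real poly \<Rightarrow> complex \<Rightarrow> complex poly" where
  "residue_poly d e h k y =
    (\<Sum>i\<le>d. \<Sum>j\<le>e. smult (of_real (coeff h i * coeff k j)) (residue_term d e y i j))"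

lemma coeff_linear_power_eq:
  fixes a :: "'a :: comm_semiring_1"
  shows "coeff ([:a, 1:] ^ n) i = of_nat (n choose i) * a ^ (n - i)"
proof (cases "i \<le> n")
  case False
  then have "degree ([:a, 1:] ^ n) < i"
    using degree_power_le[of "[:a, 1:]" n] by simp
  then show ?thesis using False by (simp add: coeff_eq_0 binomial_eq_0)
qed (simp add: coeff_linear_poly_power)

lemma coeff_residue_term:
  assumes "j \<le> e"
  shows "coeff (residue_term d e y i j) e = ceval (hadamard_term d e i j) y"
proof -
  have power: "of_nat ((e + i - j) choose l) * (y ^ j * y ^ (e + i - j - l)) =
      of_nat ((e + i - j) choose l) * y ^ (i + (e - l))" if "l \<le> e" for l
  proof (cases "l \<le> e + i - j")
    case True
    then have "i + (e - l) = j + (e + i - j - l)" using assms that by auto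
    then show ?thesis by (simp add: power_add)
  qed (simp add: binomial_eq_0)
  have "coeff (residue_term d e y i j) e = (\<Sum>l\<le>e. of_nat ((d + j - i) choose (e - l)) *
      (of_nat ((e + i - j) choose l) * (y ^ j * y ^ (e + i - j - l))))"
    unfolding residue_term_def coeff_smult coeff_mult coeff_linear_power_eq
    by (simp add: sum_distrib_left mult_ac)
  also have "\<dots> = (\<Sum>l\<le>e. of_nat ((d + j - i) choose (e - l)) *
      (of_nat ((e + i - j) choose l) * y ^ (i + (e - l))))"
    by (intro sum.cong refl) (simp only: power atMost_iff)
  also have "\<dots> = (\<Sum>l\<le>e. of_nat (((e + i - j) choose (e - l)) * ((d + j - i) choose l)) *
      y ^ (i + l))"
    by (rule sum.reindex_bij_witness[of _ "\<lambda>l. e - l" "\<lambda>l. e - l"]) auto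
  finally show ?thesis by (simp add: hadamard_term_def)
qed

lemma coeff_residue_poly:
  "coeff (residue_poly d e h k y) e = ceval (hadamard_num d e h k) y"
  by (simp add: residue_poly_def hadamard_num_def coeff_sum coeff_residue_term)

lemma top_coeff_residue_term:
  assumes "i \<le> d" and "j \<le> e"
  shows "coeff (residue_term d e y i j) (d + e) = y ^ j"
proof -
  have "d + e = degree ([:y, 1:] ^ (e + i - j)) + degree ([:1, 1:] ^ (d + j - i) :: complex poly)"
    using assms by (simp add: degree_linear_power)
  then show ?thesis
    by (simp only: residue_term_def coeff_smult coeff_mult_degree_sum)
      (simp add: degree_linear_power coeff_linear_power)
qed

lemma poly_residue_term:
  assumes "i \<le> d" and "j \<le> e" and "1 + s \<noteq> 0" and "y + s \<noteq> 0"
  shows "poly (residue_term d e y i j) s = (1 + s) ^ d * (y + s) ^ e *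
    (((y + s) / (1 + s)) ^ i * (y * (1 + s) / (y + s)) ^ j)"
proof -
  have "poly (residue_term d e y i j) s = y ^ j * ((y + s) ^ (e + i - j) * (1 + s) ^ (d + j - i))"
    by (simp add: residue_term_def)
  also have "(y + s) ^ (e + i - j) = (y + s) ^ (e + i) / (y + s) ^ j"
    using assms by (simp add: power_diff)
  also have "(1 + s) ^ (d + j - i) = (1 + s) ^ (d + j) / (1 + s) ^ i"
    using assms by (simp add: power_diff)
  finally show ?thesis
    using assms by (simp add: power_divide power_mult_distrib power_add) (simp only: mult_ac)
qed

lemma ceval_mult_ceval_altdef:
  assumes "degree h \<le> d" and "degree k \<le> e"
  shows "ceval h Y * ceval k Z =
    (\<Sum>i\<le>d. \<Sum>j\<le>e. of_real (coeff h i * coeff k j) * (Y ^ i * Z ^ j))"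
  by (simp add: ceval_altdef[OF assms(1)] ceval_altdef[OF assms(2)] sum_product mult_ac)

lemma poly_residue_poly:
  assumes "degree h \<le> d" and "degree k \<le> e" and "1 + s \<noteq> 0" and "y + s \<noteq> 0"
  shows "poly (residue_poly d e h k y) s = (1 + s) ^ d * (y + s) ^ e *
    (ceval h ((y + s) / (1 + s)) * ceval k (y * (1 + s) / (y + s)))"
proof -
  have "poly (residue_poly d e h k y) s = (\<Sum>i\<le>d. \<Sum>j\<le>e. (1 + s) ^ d * (y + s) ^ e *
      (of_real (coeff h i * coeff k j) * (((y + s) / (1 + s)) ^ i * (y * (1 + s) / (y + s)) ^ j)))"
    unfolding residue_poly_def poly_sum poly_smult
    by (intro sum.cong refl) (simp only: poly_residue_term[OF _ _ assms(3,4)] atMost_iff mult_ac)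
  then show ?thesis
    by (simp only: ceval_mult_ceval_altdef[OF assms(1,2)] sum_distrib_left)
qed

lemma top_coeff_residue_poly:
  assumes "degree h \<le> d" and "degree k \<le> e"
  shows "coeff (residue_poly d e h k y) (d + e) = ceval h 1 * ceval k y"
  by (simp add: residue_poly_def ceval_mult_ceval_altdef[OF assms] coeff_sum top_coeff_residue_term)

lemma Moebius_upper_halfplane:
  assumes "Im y > 0" and "Im ((1 - cnj y) * s) \<ge> 0"
  shows "1 + s \<noteq> 0" and "y + s \<noteq> 0" and "Im ((y + s) / (1 + s)) > 0"
proof -
  have "Im ((y + s) * cnj (1 + s)) = Im y + Im ((1 - cnj y) * s)"
    by (simp add: algebra_simps)
  then show Im_pos: "Im ((y + s) / (1 + s)) > 0"
    using assms by (simp add: Im_complex_div_gt_0)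
  show "1 + s \<noteq> 0" using Im_pos by force
  show "y + s \<noteq> 0" using Im_pos by force
qed

text \<open>If \<open>\<Theta>(h, k) - c \<Theta>(h', k')\<close> vanished at \<open>y\<close>, then so would the coefficient of \<open>s\<^bsup>e\<^esup>\<close> in a
  polynomial all of whose zeros \<open>s\<close> lie outside \<open>{s. Im ((1 - cnj y) * s) \<ge> 0}\<close>, a half-plane
  with \<open>0\<close> on its boundary. The point \<open>Y = 1\<close> corresponds to \<open>s = \<infinity>\<close>, that is, to the leading
  coefficient.\<close>

lemma hadamard_num_neq_times:
  assumes y: "Im y > 0"
    and deg: "degree h \<le> d" "degree k \<le> e" "degree h' \<le> d" "degree k' \<le> e"
    and avoid: "\<And>Y Z. Im Y \<ge> 0 \<Longrightarrow> Y \<notin> \<real>\<^sub>\<le>\<^sub>0 \<Longrightarrow> Y * Z = y \<Longrightarrow>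
      ceval h Y * ceval k Z \<noteq> c * (ceval h' Y * ceval k' Z)"
  shows "ceval (hadamard_num d e h k) y \<noteq> c * ceval (hadamard_num d e h' k') y"
proof -
  define K where "K = residue_poly d e h k y - smult c (residue_poly d e h' k' y)"
  have "coeff K (d + e) = ceval h 1 * ceval k y - c * (ceval h' 1 * ceval k' y)"
    by (simp add: K_def top_coeff_residue_poly deg)
  then have "coeff K (d + e) \<noteq> 0"
    using avoid[of 1 y] by simp
  then have K: "K \<noteq> 0" "e \<le> degree K"
    using le_degree[of K "d + e"] by auto
  have "coeff K e \<noteq> 0"
  proof (rule coeff_nonzero_of_roots_halfplane[OF _ K])
    fix s assume root: "poly K s = 0"
    show "Im ((1 - cnj y) * s) < 0"
    proof (rule ccontr)
      define Y where "Y = (y + s) / (1 + s)"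
      define Z where "Z = y * (1 + s) / (y + s)"
      assume "\<not> Im ((1 - cnj y) * s) < 0"
      then have nz: "1 + s \<noteq> 0" "y + s \<noteq> 0" and Y: "Im Y > 0"
        using Moebius_upper_halfplane[OF y, of s] by (simp_all add: Y_def)
      have "poly K s = (1 + s) ^ d * (y + s) ^ e *
          (ceval h Y * ceval k Z - c * (ceval h' Y * ceval k' Z))"
        using deg nz
        by (simp add: K_def Y_def Z_def poly_residue_poly algebra_simps)
      moreover have "Y \<notin> \<real>\<^sub>\<le>\<^sub>0" "Y * Z = y"
        using Y nz by (auto simp: complex_nonpos_Reals_iff Y_def Z_def)
      ultimately show False
        using avoid[of Y Z] Y root nz by simp
    qed
  qed
  then show ?thesis by (simp add: K_def coeff_residue_poly)
qed

section \<open>Real-rooted polynomials\<close>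

lemma real_rooted_iff:
  assumes "a \<noteq> 0"
  shows "real_rooted a \<longleftrightarrow> (\<forall>Y. Im Y > 0 \<longrightarrow> ceval a Y \<noteq> 0)"
proof -
  have "Im z = 0" if "\<And>Y. Im Y > 0 \<Longrightarrow> ceval a Y \<noteq> 0" "ceval a z = 0" for z
    using that(1)[of z] that(1)[of "cnj z"] that(2) by (force simp: ceval_cnj)
  then show ?thesis
    using assms by (auto simp: real_rooted_def ceval_def complex_is_Real_iff)
qed

lemma real_rooted_mult_iff:
  "a \<noteq> 0 \<Longrightarrow> b \<noteq> 0 \<Longrightarrow> real_rooted (a * b) \<longleftrightarrow> real_rooted a \<and> real_rooted b"
  by (auto simp: real_rooted_iff)

lemma real_rooted_linear_mult_iff: "real_rooted ([:- x, 1:] * a) \<longleftrightarrow> real_rooted a"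
proof (cases "a = 0")
  case False
  have "real_rooted [:- x, 1:]" by (auto simp: real_rooted_iff complex_eq_iff)
  then show ?thesis using False by (subst real_rooted_mult_iff) simp_all
qed simp

lemma real_rooted_minus_iff: "real_rooted (- a) \<longleftrightarrow> real_rooted a"
  by (cases "a = 0") (simp_all add: real_rooted_iff)

lemma degree_eq_0_if_no_real_roots:
  assumes "real_rooted a" and "\<And>x. poly a x \<noteq> 0"
  shows "degree a = 0"
proof (rule ccontr)
  assume "degree a \<noteq> 0"
  then have "\<not> constant (poly (map_poly complex_of_real a))"
    by (simp add: constant_degree degree_map_poly)
  then obtain z where z: "ceval a z = 0"
    using fundamental_theorem_of_algebra unfolding ceval_def by blast
  then obtain x where "z = of_real x"
    using assms(1) \<open>degree a \<noteq> 0\<close> unfolding real_rooted_def ceval_def by (auto elim: Reals_cases)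
  then show False using z assms(2) by (simp add: ceval_of_real)
qed

lemma real_rooted_decompose_multiset:
  "real_rooted a \<Longrightarrow> smult (lead_coeff a) (\<Prod>z\<in>#proots a. [:- z, 1:]) = a"
proof (induction a rule: poly_root_order_induct)
  case (no_roots a)
  then obtain c where "a = [:c:]"
    using degree_eq_0_if_no_real_roots by (metis degree_eq_zeroE)
  then show ?case by simp
next
  case (root a x n)
  then have "a \<noteq> 0" by auto
  moreover have "[:- x, 1:] ^ n \<noteq> 0" by simp
  ultimately have "real_rooted a" "proots ([:- x, 1:] ^ n * a) = replicate_mset n x + proots a"
    using root.prems by (simp_all add: real_rooted_mult_iff proots_mult proots_power)
  then show ?case
    using root.IH by (simp add: lead_coeff_mult lead_coeff_power flip: mult_smult_right)
qed simp

lemma mset_zeros_desc [simp]: "mset (zeros_desc a) = proots a"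
  by (simp add: zeros_desc_def)

lemma set_zeros_desc: "a \<noteq> 0 \<Longrightarrow> set (zeros_desc a) = {x. poly a x = 0}"
  by (simp flip: set_mset_mset)

lemma sorted_zeros_desc: "sorted_wrt (\<ge>) (zeros_desc a)"
  unfolding zeros_desc_def sorted_wrt_rev using sorted_sorted_list_of_multiset by simp

lemma zeros_desc_eqI:
  assumes "mset zs = proots a" and "sorted_wrt (\<ge>) zs"
  shows "zeros_desc a = zs"
proof -
  have "sort zs = rev zs"
    using assms(2) by (intro properties_for_sort) (simp_all add: sorted_wrt_rev)
  then show ?thesis by (simp add: zeros_desc_def flip: assms(1))
qed

lemma zeros_desc_linear_mult:
  assumes "a \<noteq> 0" and "\<forall>z\<in>set (zeros_desc a). z \<le> x"
  shows "zeros_desc ([:- x, 1:] * a) = x # zeros_desc a"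
proof (rule zeros_desc_eqI)
  show "mset (x # zeros_desc a) = proots ([:- x, 1:] * a)"
    using assms(1) by (subst proots_mult) simp_all
  show "sorted_wrt (\<ge>) (x # zeros_desc a)"
    using assms(2) sorted_zeros_desc by simp
qed

lemma real_rooted_decompose:
  assumes "real_rooted a"
  shows "smult (lead_coeff a) (\<Prod>z\<leftarrow>zeros_desc a. [:- z, 1:]) = a"
  using real_rooted_decompose_multiset[OF assms] by (simp flip: mset_zeros_desc prod_mset_prod_list)

section \<open>Interlacing sequences\<close>

definition interlacing :: "'a :: linorder list \<Rightarrow> 'a list \<Rightarrow> bool" where
  "interlacing r s \<longleftrightarrow> (length s = length r \<or> length s = length r + 1) \<and>
     (\<forall>i < length r. r ! i \<le> s ! i) \<and> (\<forall>i < length r. i + 1 < length s \<longrightarrow> s ! (i + 1) \<le> r ! i)"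

lemma interlaces_iff_interlacing:
  "interlaces b a \<longleftrightarrow> real_rooted a \<and> real_rooted b \<and>
     (a = 0 \<or> b = 0 \<or> interlacing (zeros_desc b) (zeros_desc a))"
  by (simp add: interlaces_def interlacing_def Let_def)

lemma interlacing_Nil [simp]: "interlacing r [] \<longleftrightarrow> r = []"
  by (auto simp: interlacing_def)

lemma interlacing_Cons:
  "interlacing r (x # s) \<longleftrightarrow> (r \<noteq> [] \<longrightarrow> hd r \<le> x) \<and> interlacing s r"
proof
  assume il: "interlacing r (x # s)"
  have "hd r \<le> x" if "r \<noteq> []"
    using il that unfolding interlacing_def by (cases r) auto
  moreover have "interlacing s r"
    using il unfolding interlacing_def by (auto simp: nth_Cons')
  ultimately show "(r \<noteq> [] \<longrightarrow> hd r \<le> x) \<and> interlacing s r" by blast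
next
  assume il: "(r \<noteq> [] \<longrightarrow> hd r \<le> x) \<and> interlacing s r"
  have "r ! i \<le> (x # s) ! i" if "i < length r" for i
    using il that unfolding interlacing_def by (cases i) (auto simp: hd_conv_nth)
  then show "interlacing r (x # s)"
    using il unfolding interlacing_def by auto
qed

lemma interlacing_induct [consumes 1, case_names Nil step]:
  assumes "interlacing r s"
    and "P [] []"
    and "\<And>r x s. interlacing s r \<Longrightarrow> (r \<noteq> [] \<Longrightarrow> hd r \<le> x) \<Longrightarrow> P s r \<Longrightarrow> P r (x # s)"
  shows "P r s"
  using assms(1)
proof (induction "length r + length s" arbitrary: r s rule: less_induct)
  case less
  show ?case
  proof (cases s)
    case Nil
    then show ?thesis using less.prems assms(2) by simp
  next
    case (Cons x s')
    then show ?thesis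
      using less assms(3)[of s' r x] by (simp add: interlacing_Cons)
  qed
qed

lemma interlacing_le_bound:
  assumes "interlacing r s" and "\<forall>z\<in>set s. z \<le> c"
  shows "\<forall>z\<in>set r. z \<le> c"
proof
  fix z assume "z \<in> set r"
  then obtain i where "i < length r" "z = r ! i" by (metis in_set_conv_nth)
  then have "z \<le> s ! i" "i < length s" using assms(1) by (auto simp: interlacing_def)
  then show "z \<le> c" using assms(2) nth_mem order_trans by blast
qed

definition num_greater :: "'a :: linorder \<Rightarrow> 'a list \<Rightarrow> nat" where
  "num_greater t zs = length (filter (\<lambda>z. t < z) zs)"

lemma less_nth_iff_num_greater:
  assumes "sorted_wrt (\<ge>) zs" and "i < length zs"
  shows "t < zs ! i \<longleftrightarrow> i < num_greater t zs"
  using assms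
proof (induction zs arbitrary: i)
  case (Cons x zs)
  show ?case
  proof (cases "t < x")
    case True
    then show ?thesis using Cons by (cases i) (auto simp: num_greater_def)
  next
    case False
    then have "\<forall>z\<in>set (x # zs). \<not> t < z" using Cons.prems by auto
    moreover have "(x # zs) ! i \<in> set (x # zs)" using Cons.prems(2) by (rule nth_mem)
    ultimately have "num_greater t (x # zs) = 0" "\<not> t < (x # zs) ! i"
      unfolding num_greater_def length_0_conv filter_empty_conv by blast+
    then show ?thesis by simp
  qed
qed simp

lemma interlacing_if_num_greater:
  fixes r s :: "real list"
  assumes "sorted_wrt (\<ge>) r" and "sorted_wrt (\<ge>) s"
    and lower: "\<And>t. num_greater t r \<le> num_greater t s"
    and upper: "\<And>t. num_greater t s \<le> num_greater t r + 1"
  shows "interlacing r s"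
proof -
  obtain m where "\<forall>z\<in>set r \<union> set s. m \<le> z"
    using bdd_below_finite[of "set r \<union> set s"] by (auto simp: bdd_below_def)
  then have "\<forall>z\<in>set r. m - 1 < z" "\<forall>z\<in>set s. m - 1 < z" by force+
  then have "num_greater (m - 1) r = length r" "num_greater (m - 1) s = length s"
    by (simp_all add: num_greater_def)
  then have len: "length s = length r \<or> length s = length r + 1"
    using lower[of "m - 1"] upper[of "m - 1"] by linarith
  moreover have "r ! i \<le> s ! i" if i: "i < length r" for i
  proof (rule ccontr)
    assume "\<not> r ! i \<le> s ! i"
    then have "i < num_greater (s ! i) r"
      using less_nth_iff_num_greater[OF assms(1) i, of "s ! i"] by simp
    moreover have "\<not> i < num_greater (s ! i) s"
      using less_nth_iff_num_greater[OF assms(2), of i "s ! i"] i len by auto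
    ultimately show False using lower[of "s ! i"] by linarith
  qed
  moreover have "s ! (i + 1) \<le> r ! i" if i: "i < length r" "i + 1 < length s" for i
  proof (rule ccontr)
    assume "\<not> s ! (i + 1) \<le> r ! i"
    then have "i + 1 < num_greater (r ! i) s"
      using less_nth_iff_num_greater[OF assms(2) i(2), of "r ! i"] by simp
    moreover have "\<not> i < num_greater (r ! i) r"
      using less_nth_iff_num_greater[OF assms(1) i(1), of "r ! i"] by simp
    ultimately show False using upper[of "r ! i"] by linarith
  qed
  ultimately show ?thesis unfolding interlacing_def by blast
qed

section \<open>Arguments in the upper half-plane\<close>

definition arg_sum :: "complex \<Rightarrow> real list \<Rightarrow> real" where
  "arg_sum Y zs = (\<Sum>z\<leftarrow>zs. Arg (Y - of_real z))"

lemma arg_sum_Nil [simp]: "arg_sum Y [] = 0"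
  by (simp add: arg_sum_def)

lemma arg_sum_Cons [simp]: "arg_sum Y (z # zs) = Arg (Y - of_real z) + arg_sum Y zs"
  by (simp add: arg_sum_def)

lemma Im_rcis_mult_cnj: "Im (rcis \<rho> s * cnj (rcis \<sigma> t)) = \<rho> * \<sigma> * sin (s - t)"
  by (simp add: rcis_def sin_diff algebra_simps)

lemma Arg_le_Arg_iff:
  assumes "Im v \<ge> 0" and "v \<noteq> 0" and "Im w > 0"
  shows "Arg v \<le> Arg w \<longleftrightarrow> 0 \<le> Im (w * cnj v)"
proof -
  have "w \<noteq> 0" using assms(3) by auto
  then have pos: "cmod w * cmod v > 0" using assms(2) by simp
  have polar: "Im (w * cnj v) = cmod w * cmod v * sin (Arg w - Arg v)"
    using Im_rcis_mult_cnj[of "cmod w" "Arg w" "cmod v" "Arg v"] by (simp only: rcis_cmod_Arg)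
  have "0 \<le> Im (w * cnj v) \<longleftrightarrow> 0 \<le> sin (Arg w - Arg v)"
    unfolding polar using pos by (simp only: zero_le_mult_iff) auto
  also have "\<dots> \<longleftrightarrow> 0 \<le> Arg w - Arg v"
  proof -
    have "- pi < Arg w - Arg v" "Arg w - Arg v < pi"
      using Arg_lt_pi[of w] Arg_less_0[of v] Arg_le_pi[of v] assms by linarith+
    then show ?thesis
      using sin_ge_zero[of "Arg w - Arg v"] sin_gt_zero[of "Arg v - Arg w"]
        sin_minus[of "Arg w - Arg v"] by force
  qed
  finally show ?thesis by auto
qed

lemma Arg_diff_of_real_le_iff:
  assumes "Im Y > 0"
  shows "Arg (Y - of_real z) \<le> Arg (Y - of_real z') \<longleftrightarrow> z \<le> z'"
proof -
  have "Im ((Y - of_real z') * cnj (Y - of_real z)) = (z' - z) * Im Y"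
    by (simp add: algebra_simps)
  then show ?thesis
    using assms by (subst Arg_le_Arg_iff) (auto simp: zero_le_mult_iff)
qed

text \<open>The two extreme cases are carried along because the induction step interchanges them.\<close>

lemma arg_sum_interlacing_extremes:
  assumes "interlacing r s" and "Im Y > 0"
  shows "0 \<le> arg_sum Y s - arg_sum Y r \<and>
    arg_sum Y s - arg_sum Y r \<le> (if s = [] then 0 else Arg (Y - of_real (hd s))) \<and>
    (arg_sum Y s = arg_sum Y r \<longrightarrow> s = r) \<and>
    (s \<noteq> [] \<longrightarrow> arg_sum Y s - arg_sum Y r = Arg (Y - of_real (hd s)) \<longrightarrow> tl s = r)"
  using assms(1)
proof (induction rule: interlacing_induct)
  case (step r x s)
  have Arg_pos: "0 < Arg (Y - of_real x)"
    using assms(2) Arg_lt_pi[of "Y - of_real x"] by simp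
  show ?case
  proof (cases r)
    case Nil
    then show ?thesis using step Arg_pos by (cases s) (auto simp: interlacing_Cons)
  next
    case (Cons y r')
    have "Arg (Y - of_real y) \<le> Arg (Y - of_real x)"
      "Arg (Y - of_real x) \<le> Arg (Y - of_real y) \<Longrightarrow> x = y"
      using step.hyps(2) Cons assms(2) by (auto simp: Arg_diff_of_real_le_iff)
    then show ?thesis using step.IH Cons by force
  qed
qed simp

lemma arg_sum_interlacing:
  assumes "interlacing r s" and "Im Y > 0"
  shows "arg_sum Y r \<le> arg_sum Y s" and "arg_sum Y s < arg_sum Y r + pi"
    and "arg_sum Y s = arg_sum Y r \<Longrightarrow> s = r"
  using arg_sum_interlacing_extremes[OF assms] assms(2) Arg_lt_pi[of "Y - of_real (hd s)"]
  by (auto split: if_splits)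

lemma continuous_on_arg_sum: "continuous_on {Y. Im Y > 0} (\<lambda>Y. arg_sum Y zs)"
proof (induction zs)
  case (Cons z zs)
  have "continuous_on {Y. Im Y > 0} (\<lambda>Y. Arg (Y - of_real z))"
    by (intro continuous_intros) (simp add: complex_nonpos_Reals_iff)
  then show ?case using Cons by (simp add: continuous_on_add)
qed simp

lemma Arg_tendsto_at_right_0:
  assumes "x \<noteq> 0"
  shows "((\<lambda>\<epsilon>. Arg (Complex x \<epsilon>)) \<longlongrightarrow> (if x < 0 then pi else 0)) (at_right 0)"
proof -
  have lim: "((\<lambda>\<epsilon>. Complex x \<epsilon>) \<longlongrightarrow> of_real x) (at_right 0)"
    unfolding complex_of_real_def by (intro tendsto_intros)
  show ?thesis
  proof (cases "x < 0")
    case True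
    have "((\<lambda>\<epsilon>. Arg (- Complex x \<epsilon>) + pi) \<longlongrightarrow> Arg (- of_real x) + pi) (at_right 0)"
      using True by (intro tendsto_intros lim) (simp add: complex_nonpos_Reals_iff)
    moreover have "\<forall>\<^sub>F \<epsilon> in at_right 0. Arg (- Complex x \<epsilon>) + pi = Arg (Complex x \<epsilon>)"
      using eventually_at_right_less
    proof eventually_elim
      case (elim \<epsilon>)
      then have "Arg (Complex x \<epsilon>) > 0" by (simp add: Arg_pos_iff)
      then show ?case
        using Arg_minus[of "Complex x \<epsilon>"] True by (simp add: Complex_eq_0)
    qed
    ultimately have "((\<lambda>\<epsilon>. Arg (Complex x \<epsilon>)) \<longlongrightarrow> Arg (- of_real x) + pi) (at_right 0)"
      by (rule Lim_transform_eventually)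
    then show ?thesis using True Arg_of_real[of "- x"] by simp
  next
    case False
    then have "((\<lambda>\<epsilon>. Arg (Complex x \<epsilon>)) \<longlongrightarrow> Arg (of_real x)) (at_right 0)"
      using assms by (intro tendsto_intros lim) (simp add: complex_nonpos_Reals_iff)
    then show ?thesis using False by simp
  qed
qed

lemma arg_sum_tendsto_num_greater:
  assumes "t \<notin> set zs"
  shows "((\<lambda>\<epsilon>. arg_sum (Complex t \<epsilon>) zs) \<longlongrightarrow> pi * num_greater t zs) (at_right 0)"
  using assms
proof (induction zs)
  case (Cons z zs)
  have "((\<lambda>\<epsilon>. Arg (Complex (t - z) \<epsilon>) + arg_sum (Complex t \<epsilon>) zs) \<longlongrightarrow>
      (if t - z < 0 then pi else 0) + pi * num_greater t zs) (at_right 0)"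
    using Cons by (intro tendsto_add Arg_tendsto_at_right_0) auto
  moreover have "Complex t \<epsilon> - of_real z = Complex (t - z) \<epsilon>" for \<epsilon>
    by (simp add: complex_eq_iff)
  moreover have "(if t - z < 0 then pi else 0) + pi * num_greater t zs =
      pi * num_greater t (z # zs)"
    by (simp add: num_greater_def algebra_simps)
  ultimately show ?case by simp
qed (simp add: num_greater_def)

lemma arg_sum_diff_tendsto:
  assumes "t \<notin> set r \<union> set s"
  shows "((\<lambda>\<epsilon>. arg_sum (Complex t \<epsilon>) s - arg_sum (Complex t \<epsilon>) r) \<longlongrightarrow>
    pi * (real (num_greater t s) - real (num_greater t r))) (at_right 0)"
  unfolding right_diff_distrib using assms by (intro tendsto_diff arg_sum_tendsto_num_greater) auto

lemma ex_arg_sum_diff_small: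
  assumes "\<eta> > 0"
  shows "\<exists>Y. Im Y > 0 \<and> \<bar>arg_sum Y s - arg_sum Y r\<bar> < \<eta>"
proof -
  obtain M where M: "\<forall>z\<in>set r \<union> set s. z \<le> M"
    using bdd_above_finite[of "set r \<union> set s"] by (auto simp: bdd_above_def)
  let ?Y = "Complex (M + 1)"
  have "M + 1 \<notin> set r \<union> set s" "num_greater (M + 1) r = 0" "num_greater (M + 1) s = 0"
    using M by (force simp: num_greater_def filter_empty_conv)+
  then have "((\<lambda>\<epsilon>. arg_sum (?Y \<epsilon>) s - arg_sum (?Y \<epsilon>) r) \<longlongrightarrow> 0) (at_right 0)"
    using arg_sum_diff_tendsto[of "M + 1" r s] by simp
  then have "\<forall>\<^sub>F \<epsilon> in at_right 0. \<bar>arg_sum (?Y \<epsilon>) s - arg_sum (?Y \<epsilon>) r\<bar> < \<eta>"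
    using assms by (simp add: tendsto_iff dist_real_def)
  then have "\<forall>\<^sub>F \<epsilon> in at_right 0. \<epsilon> > 0 \<and> \<bar>arg_sum (?Y \<epsilon>) s - arg_sum (?Y \<epsilon>) r\<bar> < \<eta>"
    using eventually_at_right_less by (rule eventually_conj[rotated])
  then obtain \<epsilon> where "\<epsilon> > 0" "\<bar>arg_sum (?Y \<epsilon>) s - arg_sum (?Y \<epsilon>) r\<bar> < \<eta>"
    using eventually_happens' trivial_limit_at_right_real by blast
  then show ?thesis by (intro exI[of _ "?Y \<epsilon>"]) simp
qed

lemma connected_less_if_avoids:
  fixes g :: "'a :: topological_space \<Rightarrow> 'b :: linorder_topology"
  assumes "connected S" and "continuous_on S g" and "\<And>z. z \<in> S \<Longrightarrow> g z \<noteq> c"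
    and "x \<in> S" and "g x < c" and "y \<in> S"
  shows "g y < c"
proof (rule ccontr)
  assume "\<not> g y < c"
  moreover have "connected (g ` S)"
    using assms(1,2) by (intro connected_continuous_image)
  ultimately have "c \<in> g ` S"
    using connected_contains_Icc[of "g ` S" "g x" "g y"] assms(4-6) by force
  then show False using assms(3) by blast
qed

lemma arg_sum_diff_less_if_avoids:
  assumes "\<And>Y. Im Y > 0 \<Longrightarrow> arg_sum Y s - arg_sum Y r \<noteq> c" and "c > 0" and "Im Y > 0"
  shows "arg_sum Y s - arg_sum Y r < c"
proof -
  obtain Y\<^sub>0 where "Im Y\<^sub>0 > 0" "\<bar>arg_sum Y\<^sub>0 s - arg_sum Y\<^sub>0 r\<bar> < c"
    using ex_arg_sum_diff_small[OF assms(2)] by blast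
  moreover have "continuous_on {Y. Im Y > 0} (\<lambda>Y. arg_sum Y s - arg_sum Y r)"
    by (intro continuous_intros continuous_on_arg_sum)
  moreover have "connected {Y. Im Y > 0}"
    by (intro convex_connected convex_halfspace_Im_gt)
  ultimately show ?thesis
    using connected_less_if_avoids[of "{Y. Im Y > 0}" "\<lambda>Y. arg_sum Y s - arg_sum Y r" c Y\<^sub>0 Y] assms
    by simp
qed

lemma arg_sum_diff_bounds:
  assumes nonneg: "\<And>Y. Im Y > 0 \<Longrightarrow> 0 \<le> sin (arg_sum Y s - arg_sum Y r)" and "Im Y > 0"
  shows "0 \<le> arg_sum Y s - arg_sum Y r" and "arg_sum Y s - arg_sum Y r \<le> pi"
proof -
  let ?g = "\<lambda>Y. arg_sum Y s - arg_sum Y r"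
  have neg: "sin (3 / 2 * pi) < 0" by (rule sin_lt_zero) auto
  have "?g Z \<noteq> 3 / 2 * pi" if "Im Z > 0" for Z
    using nonneg[OF that] neg by (metis not_less)
  then have upper: "?g Y < 3 / 2 * pi"
    using assms(2) by (intro arg_sum_diff_less_if_avoids) auto
  have "arg_sum Z r - arg_sum Z s \<noteq> pi / 2" if "Im Z > 0" for Z
  proof
    assume "arg_sum Z r - arg_sum Z s = pi / 2"
    then have "?g Z = - (pi / 2)" by linarith
    then show False using nonneg[OF that] by (simp only: sin_minus sin_pi_half)
  qed
  then have "arg_sum Y r - arg_sum Y s < pi / 2"
    using assms(2) by (intro arg_sum_diff_less_if_avoids) auto
  then have lower: "- ?g Y < pi / 2" by simp
  show "0 \<le> ?g Y"
    using nonneg[OF assms(2)] lower sin_gt_zero[of "- ?g Y"] sin_minus[of "?g Y"] by force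
  show "?g Y \<le> pi"
    using nonneg[OF assms(2)] upper sin_lt_zero[of "?g Y"] by force
qed

lemma ex_greater_not_mem_same_num_greater:
  fixes A :: "'a :: {dense_linorder, no_top} set"
  assumes "finite A"
  shows "\<exists>u. u \<notin> A \<and> (\<forall>z\<in>A. t < z \<longleftrightarrow> u < z)"
proof (cases "{z \<in> A. t < z} = {}")
  case True
  obtain u where "t < u" using gt_ex by blast
  then have "u \<notin> A \<and> (\<forall>z\<in>A. t < z \<longleftrightarrow> u < z)"
    using True by (auto dest: less_trans)
  then show ?thesis by blast
next
  case False
  define m where "m = Min {z \<in> A. t < z}"
  have "m \<in> A" "t < m" using Min_in[OF _ False] assms by (auto simp: m_def)
  moreover have "m \<le> z" if "z \<in> A" "t < z" for z
    using that assms by (simp add: m_def)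
  moreover obtain u where "t < u" "u < m" using dense[OF \<open>t < m\<close>] by blast
  ultimately have "u \<notin> A \<and> (\<forall>z\<in>A. t < z \<longleftrightarrow> u < z)"
    by (meson leD less_le_trans less_trans)
  then show ?thesis by blast
qed

lemma num_greater_bounds:
  assumes bounds: "\<And>Y. Im Y > 0 \<Longrightarrow> 0 \<le> arg_sum Y s - arg_sum Y r \<and> arg_sum Y s - arg_sum Y r \<le> pi"
  shows "num_greater t r \<le> num_greater t s" and "num_greater t s \<le> num_greater t r + 1"
proof -
  obtain u where u: "u \<notin> set r \<union> set s" "\<forall>z\<in>set r \<union> set s. t < z \<longleftrightarrow> u < z"
    using ex_greater_not_mem_same_num_greater[of "set r \<union> set s" t] by auto
  have same: "num_greater t r = num_greater u r" "num_greater t s = num_greater u s"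
    unfolding num_greater_def using u(2) by (auto intro!: arg_cong[where f = length] filter_cong)
  let ?n = "real (num_greater u s) - real (num_greater u r)"
  have eventually: "\<forall>\<^sub>F \<epsilon> in at_right 0. 0 \<le> arg_sum (Complex u \<epsilon>) s - arg_sum (Complex u \<epsilon>) r \<and>
      arg_sum (Complex u \<epsilon>) s - arg_sum (Complex u \<epsilon>) r \<le> pi"
    using eventually_at_right_less by eventually_elim (rule bounds, simp)
  note lim = arg_sum_diff_tendsto[OF u(1)]
  have "0 \<le> pi * ?n"
    by (rule tendsto_lowerbound[OF lim]) (use eventually in \<open>auto elim: eventually_mono\<close>)
  then have "0 \<le> ?n" using pi_gt_zero by (simp only: zero_le_mult_iff) linarith
  moreover have "pi * ?n \<le> pi * 1"
    unfolding mult_1_right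
    by (rule tendsto_upperbound[OF lim]) (use eventually in \<open>auto elim: eventually_mono\<close>)
  then have "?n \<le> 1" by (simp only: mult_le_cancel_left_pos pi_gt_zero)
  ultimately show "num_greater t r \<le> num_greater t s" "num_greater t s \<le> num_greater t r + 1"
    unfolding same by linarith+
qed

section \<open>Proper position\<close>

definition proper_position :: "real poly \<Rightarrow> real poly \<Rightarrow> bool" where
  "proper_position b a \<longleftrightarrow> (\<forall>Y. Im Y > 0 \<longrightarrow> 0 \<le> Im (ceval a Y * cnj (ceval b Y)))"

lemma proper_position_add_self_iff: "proper_position b (a + b) \<longleftrightarrow> proper_position b a"
  by (simp add: proper_position_def algebra_simps)

lemma ceval_prod_linear_polar:
  "ceval (\<Prod>z\<leftarrow>zs. [:- z, 1:]) Y =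
    rcis (cmod (ceval (\<Prod>z\<leftarrow>zs. [:- z, 1:]) Y)) (arg_sum Y zs)"
proof (induction zs)
  case (Cons z zs)
  let ?P = "\<Prod>z\<leftarrow>zs. [:- z, 1:]"
  have "ceval (\<Prod>z\<leftarrow>z # zs. [:- z, 1:]) Y = (Y - of_real z) * ceval ?P Y"
    by (simp add: algebra_simps)
  also have "\<dots> = rcis (cmod (Y - of_real z)) (Arg (Y - of_real z)) *
      rcis (cmod (ceval ?P Y)) (arg_sum Y zs)"
    by (simp only: rcis_cmod_Arg Cons.IH[symmetric])
  also have "\<dots> = rcis (cmod ((Y - of_real z) * ceval ?P Y)) (arg_sum Y (z # zs))"
    by (simp add: rcis_mult norm_mult)
  also have "(Y - of_real z) * ceval ?P Y = ceval (\<Prod>z\<leftarrow>z # zs. [:- z, 1:]) Y"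
    by (simp add: algebra_simps)
  finally show ?case .
qed simp

lemma ceval_polar:
  assumes "real_rooted a" and "0 \<le> lead_coeff a"
  shows "ceval a Y = rcis (cmod (ceval a Y)) (arg_sum Y (zeros_desc a))"
proof -
  let ?P = "\<Prod>z\<leftarrow>zeros_desc a. [:- z, 1:]"
  have a: "ceval a Y = of_real (lead_coeff a) * ceval ?P Y"
    by (subst real_rooted_decompose[OF assms(1), symmetric]) simp
  also have "\<dots> = of_real (lead_coeff a) * rcis (cmod (ceval ?P Y)) (arg_sum Y (zeros_desc a))"
    by (simp only: ceval_prod_linear_polar[symmetric])
  also have "\<dots> = rcis (cmod (ceval a Y)) (arg_sum Y (zeros_desc a))"
    using assms(2) by (simp add: a norm_mult rcis_def mult.assoc)
  finally show ?thesis .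
qed

lemma Im_ceval_mult_cnj_polar:
  assumes "real_rooted a" "0 \<le> lead_coeff a" "real_rooted b" "0 \<le> lead_coeff b"
  shows "Im (ceval a Y * cnj (ceval b Y)) = cmod (ceval a Y) * cmod (ceval b Y) *
    sin (arg_sum Y (zeros_desc a) - arg_sum Y (zeros_desc b))"
  using Im_rcis_mult_cnj[of "cmod (ceval a Y)" "arg_sum Y (zeros_desc a)"
      "cmod (ceval b Y)" "arg_sum Y (zeros_desc b)"]
  by (simp only: ceval_polar[OF assms(1,2), symmetric] ceval_polar[OF assms(3,4), symmetric])

lemma Im_ceval_mult_cnj_nonneg_iff:
  assumes "real_rooted a" "0 \<le> lead_coeff a" "a \<noteq> 0" "real_rooted b" "0 \<le> lead_coeff b" "b \<noteq> 0"
    and "Im Y > 0"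
  shows "0 \<le> Im (ceval a Y * cnj (ceval b Y)) \<longleftrightarrow>
    0 \<le> sin (arg_sum Y (zeros_desc a) - arg_sum Y (zeros_desc b))"
proof -
  have "cmod (ceval a Y) * cmod (ceval b Y) > 0"
    using assms by (simp add: real_rooted_iff)
  then show ?thesis
    unfolding Im_ceval_mult_cnj_polar[OF assms(1,2,4,5)] by (simp only: zero_le_mult_iff) auto
qed

text \<open>A version of the Hermite--Biehler theorem. For the converse direction, let \<open>Y\<close> tend to a
  real \<open>t\<close>: the difference of the arguments tends to \<open>\<pi>\<close> times the difference of the numbers of
  zeros beyond \<open>t\<close>.\<close>

theorem interlaces_iff_proper_position:
  assumes lead: "0 \<le> lead_coeff a" "0 \<le> lead_coeff b"
  shows "interlaces b a \<longleftrightarrow> real_rooted a \<and> real_rooted b \<and> proper_position b a"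
proof (cases "a = 0 \<or> b = 0")
  case True
  then show ?thesis by (auto simp: interlaces_def proper_position_def)
next
  case False
  have "interlacing (zeros_desc b) (zeros_desc a) \<longleftrightarrow> proper_position b a"
    if rr: "real_rooted a" "real_rooted b"
  proof -
    let ?g = "\<lambda>Y. arg_sum Y (zeros_desc a) - arg_sum Y (zeros_desc b)"
    have Im_iff: "0 \<le> Im (ceval a Y * cnj (ceval b Y)) \<longleftrightarrow> 0 \<le> sin (?g Y)" if "Im Y > 0" for Y
      using False rr lead that by (intro Im_ceval_mult_cnj_nonneg_iff) auto
    show ?thesis
    proof
      assume "interlacing (zeros_desc b) (zeros_desc a)"
      then have "0 \<le> sin (?g Y)" if "Im Y > 0" for Y
        using arg_sum_interlacing[OF _ that, of "zeros_desc b" "zeros_desc a"]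
        by (intro sin_ge_zero) auto
      then show "proper_position b a"
        by (simp add: proper_position_def Im_iff del: times_complex.sel)
    next
      assume "proper_position b a"
      then have "0 \<le> sin (?g Y)" if "Im Y > 0" for Y
        using that by (simp add: proper_position_def Im_iff del: times_complex.sel)
      then show "interlacing (zeros_desc b) (zeros_desc a)"
        by (intro interlacing_if_num_greater sorted_zeros_desc num_greater_bounds conjI
            arg_sum_diff_bounds) auto
    qed
  qed
  then show ?thesis using False by (auto simp: interlaces_iff_interlacing)
qed

text \<open>The interlacing hypotheses only bound the argument of \<open>a / b\<close> by \<open>2\<pi>\<close>; since it is
  continuous, small somewhere, and never equal to \<open>\<pi>\<close>, it stays below \<open>\<pi>\<close>.\<close>

lemma interlaces_trans:
  assumes lead: "0 \<le> lead_coeff a" "0 \<le> lead_coeff b"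
    and "interlaces m a" and "interlaces b m" and "m \<noteq> 0"
    and avoid: "\<And>Y. Im Y > 0 \<Longrightarrow> ceval a Y / ceval b Y \<notin> \<real>\<^sub>\<le>\<^sub>0"
  shows "interlaces b a"
proof -
  let ?s = "\<lambda>Y. arg_sum Y (zeros_desc a)" and ?r = "\<lambda>Y. arg_sum Y (zeros_desc b)"
  have rr: "real_rooted a" "real_rooted b"
    using assms(3,4) by (simp_all add: interlaces_def)
  have "a \<noteq> 0" "b \<noteq> 0" using avoid[of \<i>] by auto
  then have il: "interlacing (zeros_desc m) (zeros_desc a)"
    "interlacing (zeros_desc b) (zeros_desc m)"
    using assms(3-5) by (simp_all add: interlaces_iff_interlacing)
  have "?s Y - ?r Y \<noteq> pi" if "Im Y > 0" for Y
  proof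
    assume "?s Y - ?r Y = pi"
    then have "ceval a Y / ceval b Y = rcis (cmod (ceval a Y) / cmod (ceval b Y)) pi"
      using ceval_polar[OF rr(1) lead(1), of Y] ceval_polar[OF rr(2) lead(2), of Y]
      by (metis rcis_divide)
    also have "\<dots> \<in> \<real>\<^sub>\<le>\<^sub>0" by (simp add: complex_nonpos_Reals_iff)
    finally show False using avoid[OF that] by blast
  qed
  then have "?s Y - ?r Y < pi" if "Im Y > 0" for Y
    using that by (intro arg_sum_diff_less_if_avoids) auto
  moreover have "0 \<le> ?s Y - ?r Y" if "Im Y > 0" for Y
    using arg_sum_interlacing(1)[OF il(1) that] arg_sum_interlacing(1)[OF il(2) that] by simp
  ultimately have "proper_position b a"
    unfolding proper_position_def Im_ceval_mult_cnj_polar[OF rr(1) lead(1) rr(2) lead(2)]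
    by (intro allI impI mult_nonneg_nonneg norm_ge_zero sin_ge_zero) (simp_all add: less_imp_le)
  then show ?thesis using lead rr by (simp add: interlaces_iff_proper_position)
qed

lemma zeros_desc_eq_if_Im_eq_0:
  assumes lead: "0 \<le> lead_coeff a" "0 \<le> lead_coeff b" and nz: "a \<noteq> 0" "b \<noteq> 0"
    and "interlaces b a" and Y: "Im Y > 0" and "Im (ceval a Y * cnj (ceval b Y)) = 0"
  shows "zeros_desc a = zeros_desc b"
proof -
  let ?g = "arg_sum Y (zeros_desc a) - arg_sum Y (zeros_desc b)"
  have rr: "real_rooted a" "real_rooted b" and il: "interlacing (zeros_desc b) (zeros_desc a)"
    using assms(5) nz by (simp_all add: interlaces_iff_interlacing)
  have "ceval a Y \<noteq> 0" "ceval b Y \<noteq> 0"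
    using rr nz Y by (simp_all add: real_rooted_iff)
  then have "sin ?g = 0"
    using assms(7) unfolding Im_ceval_mult_cnj_polar[OF rr(1) lead(1) rr(2) lead(2)] by simp
  moreover have "0 \<le> ?g" "?g < pi"
    using arg_sum_interlacing(1,2)[OF il Y] by simp_all
  ultimately have "?g = 0" using sin_gt_zero[of ?g] by linarith
  then show ?thesis using arg_sum_interlacing(3)[OF il Y] by simp
qed

lemma real_rooted_eqI:
  assumes rr: "real_rooted a" "real_rooted b" and zeros: "zeros_desc a = zeros_desc b"
    and "poly a x = poly b x" and "poly b x \<noteq> 0"
  shows "a = b"
proof -
  let ?P = "\<Prod>z\<leftarrow>zeros_desc b. [:- z, 1:]"
  have a: "smult (lead_coeff a) ?P = a" and b: "smult (lead_coeff b) ?P = b"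
    using real_rooted_decompose[OF rr(1)] real_rooted_decompose[OF rr(2)]
    by (simp_all only: zeros)
  have "lead_coeff a * poly ?P x = lead_coeff b * poly ?P x"
    using assms(4) by (metis a b poly_smult)
  moreover have "poly ?P x \<noteq> 0"
    using assms(5) by (metis b mult_zero_right poly_smult)
  ultimately have "lead_coeff a = lead_coeff b" by simp
  then show ?thesis by (metis a b)
qed

lemma real_rooted_diff:
  assumes lead: "0 \<le> lead_coeff a" "0 \<le> lead_coeff b"
    and "interlaces b a" and "poly a x = poly b x" and "poly b x \<noteq> 0"
  shows "real_rooted (a - b)"
proof (cases "a = b")
  case True
  then show ?thesis by (simp add: real_rooted_def)
next
  case False
  have nz: "a \<noteq> 0" "b \<noteq> 0" using assms(4,5) by auto
  have "ceval (a - b) Y \<noteq> 0" if Y: "Im Y > 0" for Y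
  proof
    assume "ceval (a - b) Y = 0"
    then have "Im (ceval a Y * cnj (ceval b Y)) = 0" by simp
    then have "zeros_desc a = zeros_desc b"
      using zeros_desc_eq_if_Im_eq_0[OF lead nz assms(3) Y] by blast
    then show False
      using real_rooted_eqI[of a b x] assms(3-5) False by (simp add: interlaces_def)
  qed
  then show ?thesis using False by (simp add: real_rooted_iff)
qed

section \<open>Polynomials with nonnegative coefficients\<close>

lemma nonneg_coeffs_lead_coeff: "nonneg_coeffs a \<Longrightarrow> 0 \<le> lead_coeff a"
  by (simp add: nonneg_coeffs_def)

lemma nonneg_coeffs_add: "nonneg_coeffs a \<Longrightarrow> nonneg_coeffs b \<Longrightarrow> nonneg_coeffs (a + b)"
  by (simp add: nonneg_coeffs_def)

lemma nonneg_coeffs_mult: "nonneg_coeffs a \<Longrightarrow> nonneg_coeffs b \<Longrightarrow> nonneg_coeffs (a * b)"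
  by (auto simp: nonneg_coeffs_def coeff_mult intro!: sum_nonneg)

lemma nonneg_coeffs_recip_poly: "nonneg_coeffs a \<Longrightarrow> nonneg_coeffs (recip_poly d a)"
  by (simp add: nonneg_coeffs_def coeff_recip_poly)

lemma nonneg_coeffs_pCons: "0 \<le> c \<Longrightarrow> nonneg_coeffs a \<Longrightarrow> nonneg_coeffs (pCons c a)"
  by (auto simp: nonneg_coeffs_def coeff_pCons split: nat.split)

lemma nonneg_coeffs_0: "nonneg_coeffs 0"
  by (simp add: nonneg_coeffs_def)

lemma poly_pos_if_nonneg_coeffs:
  assumes "nonneg_coeffs a" and "a \<noteq> 0" and "x > 0"
  shows "poly a x > 0"
proof -
  have "lead_coeff a > 0"
    using assms(1,2) nonneg_coeffs_lead_coeff[of a] by (simp add: order_less_le)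
  then have "0 < lead_coeff a * x ^ degree a"
    using assms(3) by simp
  also have "\<dots> \<le> (\<Sum>i\<le>degree a. coeff a i * x ^ i)"
    using assms by (intro member_le_sum) (auto simp: nonneg_coeffs_def)
  finally show ?thesis by (simp add: poly_altdef)
qed

lemma zeros_desc_nonpos:
  assumes "nonneg_coeffs a" and "a \<noteq> 0"
  shows "\<forall>z\<in>set (zeros_desc a). z \<le> 0"
proof
  fix z assume "z \<in> set (zeros_desc a)"
  then have "poly a z = 0" using set_zeros_desc[OF assms(2)] by auto
  then show "z \<le> 0" using poly_pos_if_nonneg_coeffs[OF assms, of z] by force
qed

lemma nonneg_coeffs_if_zeros_desc_nonpos:
  assumes "real_rooted a" and "0 \<le> lead_coeff a" and "\<forall>z\<in>set (zeros_desc a). z \<le> 0"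
  shows "nonneg_coeffs a"
proof -
  have "nonneg_coeffs (\<Prod>z\<leftarrow>zs. [:- z, 1:])" if "\<forall>z\<in>set zs. z \<le> 0" for zs :: "real list"
    using that
  proof (induction zs)
    case Nil
    then show ?case by (simp add: nonneg_coeffs_def)
  next
    case (Cons z zs)
    then have "nonneg_coeffs [:- z, 1:]"
      by (intro nonneg_coeffs_pCons nonneg_coeffs_0) auto
    then show ?case
      using Cons nonneg_coeffs_mult by (simp del: mult_pCons_left)
  qed
  then have "nonneg_coeffs (smult (lead_coeff a) (\<Prod>z\<leftarrow>zeros_desc a. [:- z, 1:]))"
    using assms(2,3) by (simp add: nonneg_coeffs_def)
  then show ?thesis by (simp only: real_rooted_decompose[OF assms(1)])
qed

lemma interlaces_X_mult:
  assumes "nonneg_coeffs a" and "nonneg_coeffs b" and "interlaces b a"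
  shows "interlaces a ([:0, 1:] * b)"
proof -
  have rr: "real_rooted a" "real_rooted ([:0, 1:] * b)"
    using assms(3) real_rooted_linear_mult_iff[of 0 b] by (simp_all add: interlaces_def)
  show ?thesis
  proof (cases "a = 0 \<or> b = 0")
    case True
    then show ?thesis using rr by (auto simp: interlaces_def)
  next
    case False
    then have "zeros_desc ([:0, 1:] * b) = 0 # zeros_desc b"
      using zeros_desc_linear_mult[of b 0] zeros_desc_nonpos[OF assms(2)] by simp
    then show ?thesis
      using False rr assms(3) zeros_desc_nonpos[OF assms(1)]
      by (auto simp: interlaces_iff_interlacing interlacing_Cons)
  qed
qed

text \<open>All zeros of \<open>b\<close> are nonpositive, so the zero \<open>x\<close> of \<open>a - b\<close> has to be its largest one,
  which decides the sign of \<open>a - b\<close>.\<close>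

lemma interlaces_diff:
  assumes nonneg: "nonneg_coeffs a" "nonneg_coeffs b"
    and "interlaces b a" and "poly a x = poly b x" and "x > 0" and "b \<noteq> 0" and "a \<noteq> b"
  shows "0 \<le> lead_coeff (a - b)" and "interlaces b (a - b)"
proof -
  note lead = nonneg[THEN nonneg_coeffs_lead_coeff]
  have "poly b x > 0"
    using nonneg(2) \<open>b \<noteq> 0\<close> \<open>x > 0\<close> by (rule poly_pos_if_nonneg_coeffs)
  then have rr: "real_rooted (a - b)" "real_rooted b"
    using real_rooted_diff[OF lead assms(3,4)] assms(3) by (auto simp: interlaces_def)
  have pp: "proper_position b (a - b)"
    using assms(3) lead proper_position_add_self_iff[of b "a - b"]
    by (simp add: interlaces_iff_proper_position)
  show lead_diff: "0 \<le> lead_coeff (a - b)"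
  proof (rule ccontr)
    assume "\<not> 0 \<le> lead_coeff (a - b)"
    then have "0 \<le> lead_coeff (b - a)"
      using lead_coeff_minus[of "a - b"] by simp
    moreover have "real_rooted (b - a)"
      using rr(1) real_rooted_minus_iff[of "a - b"] by simp
    moreover have "proper_position (b - a) b"
      using pp by (simp add: proper_position_def algebra_simps)
    ultimately have "interlaces (b - a) b"
      using lead(2) rr(2) by (simp add: interlaces_iff_proper_position)
    then have "interlacing (zeros_desc (b - a)) (zeros_desc b)"
      using \<open>b \<noteq> 0\<close> \<open>a \<noteq> b\<close> by (simp add: interlaces_iff_interlacing)
    then have "\<forall>z\<in>set (zeros_desc (b - a)). z \<le> 0"
      using zeros_desc_nonpos[OF nonneg(2) \<open>b \<noteq> 0\<close>] by (rule interlacing_le_bound)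
    moreover have "x \<in> set (zeros_desc (b - a))"
      using assms(4) \<open>a \<noteq> b\<close> by (simp add: set_zeros_desc)
    ultimately show False using \<open>x > 0\<close> by force
  qed
  show "interlaces b (a - b)"
    using lead_diff lead rr pp by (simp add: interlaces_iff_proper_position)
qed

lemma interlaces_linear_multD:
  assumes "interlaces b ([:- x, 1:] * c)" and "b \<noteq> 0" and "c \<noteq> 0"
    and "\<forall>z\<in>set (zeros_desc b). z \<le> y" and "y < x"
  shows "interlaces c b"
proof -
  let ?p = "[:- x, 1:] * c"
  have "?p \<noteq> 0" using assms(3) by (simp del: mult_pCons_left)
  then have il: "interlacing (zeros_desc b) (zeros_desc ?p)"
    using assms(1,2) by (simp add: interlaces_iff_interlacing del: mult_pCons_left)
  have "x \<in> set (zeros_desc ?p)"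
    unfolding set_zeros_desc[OF \<open>?p \<noteq> 0\<close>] by simp
  then obtain z zs where zs: "zeros_desc ?p = z # zs" by (cases "zeros_desc ?p") auto
  then have il': "interlacing zs (zeros_desc b)" using il by (simp add: interlacing_Cons)
  then have "z = x"
    using interlacing_le_bound[OF il' assms(4)] \<open>y < x\<close> \<open>x \<in> set (zeros_desc ?p)\<close> zs by force
  have "add_mset x (proots c) = proots ?p"
    using assms(3) by (subst proots_mult) simp_all
  also have "\<dots> = add_mset x (mset zs)"
    using mset_zeros_desc[of ?p] by (simp only: zs \<open>z = x\<close> mset.simps)
  finally have "zeros_desc c = zs"
    using sorted_zeros_desc[of ?p] zs by (intro zeros_desc_eqI) simp_all
  moreover have "real_rooted c" "real_rooted b"
    using assms(1) by (simp_all only: interlaces_def real_rooted_linear_mult_iff)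
  ultimately show ?thesis using il' by (simp add: interlaces_iff_interlacing)
qed

lemma interlaces_diff_quotient:
  assumes nonneg: "nonneg_coeffs a" "nonneg_coeffs b"
    and "interlaces b a" and "x > 0" and quotient: "a - b = [:- x, 1:] * c"
  shows "nonneg_coeffs c" and "interlaces c b"
proof -
  have "nonneg_coeffs c \<and> interlaces c b"
  proof (cases "c = 0")
    case True
    then show ?thesis using assms(3) by (simp add: nonneg_coeffs_0 interlaces_def real_rooted_def)
  next
    case False
    then have "a \<noteq> b" using quotient by (auto simp del: mult_pCons_left)
    have root: "poly a x = poly b x"
      using arg_cong[OF quotient, of "\<lambda>p. poly p x"] by simp
    have "b \<noteq> 0"
      using poly_pos_if_nonneg_coeffs[OF nonneg(1) _ \<open>x > 0\<close>] root \<open>a \<noteq> b\<close> by auto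
    note diff = interlaces_diff[OF nonneg assms(3) root \<open>x > 0\<close> \<open>b \<noteq> 0\<close> \<open>a \<noteq> b\<close>,
      unfolded quotient]
    have il: "interlaces c b"
      using interlaces_linear_multD[OF diff(2) \<open>b \<noteq> 0\<close> False]
        zeros_desc_nonpos[OF nonneg(2) \<open>b \<noteq> 0\<close>] \<open>x > 0\<close> by blast
    then have "interlacing (zeros_desc c) (zeros_desc b)"
      using False \<open>b \<noteq> 0\<close> by (simp add: interlaces_iff_interlacing)
    then have "\<forall>z\<in>set (zeros_desc c). z \<le> 0"
      using zeros_desc_nonpos[OF nonneg(2) \<open>b \<noteq> 0\<close>] by (rule interlacing_le_bound)
    moreover have "0 \<le> lead_coeff c"
      using diff(1) by (simp only: lead_coeff_mult) simp
    ultimately show ?thesis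
      using il by (auto simp: interlaces_def intro: nonneg_coeffs_if_zeros_desc_nonpos)
  qed
  then show "nonneg_coeffs c" "interlaces c b" by auto
qed

section \<open>Quotients in the sector between \<open>1\<close> and \<open>Y\<close>\<close>

definition cone_ratio :: "real poly \<Rightarrow> real poly \<Rightarrow> bool" where
  "cone_ratio h g \<longleftrightarrow> (\<forall>Y. Y \<notin> \<real>\<^sub>\<le>\<^sub>0 \<longrightarrow>
     ceval h Y \<noteq> 0 \<and> ceval g Y \<noteq> 0 \<and> ceval h Y / ceval g Y \<in> complex_cone 0 (Arg Y))"

lemma cone_ratioD:
  assumes "cone_ratio h g" and "Y \<notin> \<real>\<^sub>\<le>\<^sub>0"
  shows "ceval h Y \<noteq> 0" and "ceval g Y \<noteq> 0"
    and "ceval h Y / ceval g Y \<in> complex_cone 0 (Arg Y)"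
  using assms by (auto simp: cone_ratio_def)

lemma mem_complex_cone_0_Arg_iff:
  "w \<in> complex_cone 0 (Arg Y) \<longleftrightarrow> w = 0 \<or> Arg w \<in> closed_segment 0 (Arg Y)"
  using Arg_bounded[of Y] by (intro in_complex_cone_iff_Arg) auto

lemma of_real_mem_complex_cone_0:
  "0 \<le> r \<Longrightarrow> of_real r \<in> complex_cone 0 \<theta>"
  unfolding complex_cone_def by (force intro: image_eqI[of _ _ "(r, 0)"])

lemma cone_ratio_self:
  assumes "cone_ratio h g"
  shows "cone_ratio h h" and "cone_ratio g g"
  using cone_ratioD(1,2)[OF assms] of_real_mem_complex_cone_0[of 1]
  by (simp_all add: cone_ratio_def)

lemma cnj_mem_complex_cone_0_Arg:
  assumes "w \<in> complex_cone 0 (Arg (cnj Y))" and "Im Y < 0"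
  shows "cnj w \<in> complex_cone 0 (Arg Y)"
proof -
  have Arg_cnj_Y: "0 < Arg (cnj Y)" "Arg (cnj Y) < pi" "Arg Y = - Arg (cnj Y)"
    using assms(2) Arg_lt_pi[of "cnj Y"] Arg_cnj[of Y] by (auto simp: complex_is_Real_iff)
  then have "w = 0 \<or> 0 \<le> Arg w \<and> Arg w \<le> Arg (cnj Y)"
    using assms(1) by (simp add: mem_complex_cone_0_Arg_iff closed_segment_eq_real_ivl)
  moreover have "Arg (cnj w) = - Arg w" if "Arg w < pi"
    using that Arg_cnj[of w] Arg_eq_0_pi[of w] by auto
  ultimately show ?thesis
    unfolding mem_complex_cone_0_Arg_iff closed_segment_eq_real_ivl using Arg_cnj_Y by auto
qed

lemma mem_complex_cone_0_Arg_iff_Im: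
  assumes "Im Y > 0"
  shows "w \<in> complex_cone 0 (Arg Y) \<longleftrightarrow> 0 \<le> Im w \<and> 0 \<le> Im (Y / w)"
proof (cases "w = 0")
  case False
  have "0 \<le> Arg Y" using assms by (simp add: Arg_less_0)
  then have "w \<in> complex_cone 0 (Arg Y) \<longleftrightarrow> 0 \<le> Arg w \<and> Arg w \<le> Arg Y"
    using False by (simp add: mem_complex_cone_0_Arg_iff closed_segment_eq_real_ivl)
  also have "\<dots> \<longleftrightarrow> 0 \<le> Im w \<and> 0 \<le> Im (Y / w)"
    using Arg_le_Arg_iff[of w Y] False assms by (auto simp only: Arg_less_0 Im_complex_div_ge_0)
  finally show ?thesis .
qed simp

lemma ceval_divide_mem_complex_cone:
  assumes nonneg: "nonneg_coeffs h" "nonneg_coeffs g" and "interlaces g h" and Y: "Im Y > 0"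
  shows "ceval h Y / ceval g Y \<in> complex_cone 0 (Arg Y)"
  unfolding mem_complex_cone_0_Arg_iff_Im[OF Y]
proof
  note lead = nonneg[THEN nonneg_coeffs_lead_coeff]
  have "proper_position g h"
    using assms(3) lead by (simp add: interlaces_iff_proper_position)
  then show "0 \<le> Im (ceval h Y / ceval g Y)"
    using Y unfolding Im_complex_div_ge_0 by (simp add: proper_position_def)
  have "proper_position h ([:0, 1:] * g)"
    using interlaces_X_mult[OF nonneg assms(3)] lead by (simp add: interlaces_iff_proper_position)
  then have "0 \<le> Im (Y * ceval g Y / ceval h Y)"
    using Y unfolding Im_complex_div_ge_0 by (simp add: proper_position_def)
  then show "0 \<le> Im (Y / (ceval h Y / ceval g Y))" by simp
qed

lemma cone_ratio_if_interlaces: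
  assumes nonneg: "nonneg_coeffs h" "nonneg_coeffs g" and nz: "h \<noteq> 0" "g \<noteq> 0"
    and il: "interlaces g h"
  shows "cone_ratio h g"
  unfolding cone_ratio_def
proof (intro allI impI)
  let ?Q = "\<lambda>Y. ceval h Y \<noteq> 0 \<and> ceval g Y \<noteq> 0 \<and> ceval h Y / ceval g Y \<in> complex_cone 0 (Arg Y)"
  have upper: "?Q Y" if "Im Y > 0" for Y
    using ceval_divide_mem_complex_cone[OF nonneg il that] il nz that
    by (simp add: interlaces_def real_rooted_iff)
  fix Y :: complex assume "Y \<notin> \<real>\<^sub>\<le>\<^sub>0"
  then consider "Im Y > 0" | "Im Y < 0" | "Im Y = 0" "Re Y > 0"
    by (cases "Im Y" "0 :: real" rule: linorder_cases) (auto simp: complex_nonpos_Reals_iff)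
  then show "?Q Y"
  proof cases
    case 1
    then show ?thesis by (rule upper)
  next
    case 2
    then show ?thesis
      using upper[of "cnj Y"] cnj_mem_complex_cone_0_Arg[of "ceval h (cnj Y) / ceval g (cnj Y)" Y]
      by (simp add: ceval_cnj)
  next
    case 3
    define x where "x = Re Y"
    have Y: "Y = of_real x" and "x > 0" using 3 by (simp_all add: x_def complex_eq_iff)
    then have "poly h x > 0" "poly g x > 0"
      using nonneg nz by (simp_all add: poly_pos_if_nonneg_coeffs)
    then show ?thesis
      using of_real_mem_complex_cone_0[of "poly h x / poly g x"] by (simp add: Y ceval_of_real)
  qed
qed

lemma Arg_mult_upper_halfplane:
  assumes "Im Y \<ge> 0" and "Im (Y * Z) > 0"
  shows "Arg (Y * Z) = Arg Y + Arg Z"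
proof -
  have "Y \<noteq> 0" "Z \<noteq> 0" using assms(2) by auto
  then show ?thesis
    using Arg_times'[of Y Z] Arg_less_0[of Y] Arg_bounded[of Y] Arg_bounded[of Z]
      Arg_lt_pi[of "Y * Z"] assms by (auto simp del: times_complex.sel split: if_splits)
qed

lemma cofactor_not_nonpos_Reals:
  assumes "Im Y \<ge> 0" and "Im (Y * Z) > 0"
  shows "Z \<notin> \<real>\<^sub>\<le>\<^sub>0"
proof -
  have "Z \<noteq> 0" "0 \<le> Arg Y" using assms by (auto simp: Arg_less_0)
  moreover have "Arg Y + Arg Z < pi"
    using Arg_mult_upper_halfplane[OF assms] Arg_lt_pi[of "Y * Z"] assms(2) by simp
  ultimately show ?thesis
    using Arg_eq_pi[of Z] by (auto simp: complex_nonpos_Reals_iff complex_eq_iff)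
qed

lemma complex_cone_mult_not_nonpos:
  assumes Y: "Im Y \<ge> 0" "Y \<notin> \<real>\<^sub>\<le>\<^sub>0" and "Im (Y * Z) > 0"
    and "u \<in> complex_cone 0 (Arg Y)" and "v \<in> complex_cone 0 (Arg Z)" and "u \<noteq> 0" and "v \<noteq> 0"
  shows "u * v \<notin> \<real>\<^sub>\<le>\<^sub>0"
proof -
  have "Arg (Y * Z) = Arg Y + Arg Z" using Y(1) assms(3) by (rule Arg_mult_upper_halfplane)
  moreover have "0 \<le> Arg Y" using Y(1) by (simp add: Arg_less_0)
  moreover have "Arg Y < pi"
    using Y(2) Arg_eq_pi[of Y] Arg_le_pi[of Y] by (force simp: complex_nonpos_Reals_iff)
  moreover have "Arg (Y * Z) < pi" using Arg_lt_pi[of "Y * Z"] assms(3) by auto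
  moreover have "Arg u \<in> closed_segment 0 (Arg Y)" "Arg v \<in> closed_segment 0 (Arg Z)"
    using assms(4-7) by (simp_all add: mem_complex_cone_0_Arg_iff)
  ultimately have "- pi < Arg u + Arg v" "Arg u + Arg v < pi"
    using mpi_less_Arg[of Z] by (auto simp: closed_segment_eq_real_ivl split: if_splits)
  then have "Arg (u * v) < pi" using assms(6,7) by (simp add: Arg_times)
  then have "\<not> (Re (u * v) < 0 \<and> Im (u * v) = 0)"
    using Arg_eq_pi[of "u * v"] by simp
  moreover have "u * v \<noteq> 0" using assms(6,7) by simp
  ultimately show ?thesis
    by (auto simp: complex_nonpos_Reals_iff complex_eq_iff
        simp del: times_complex.sel mult_eq_0_iff)
qed

section \<open>Hadamard products preserve interlacing\<close>

lemma hadamard_num_ratio_not_nonpos: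
  assumes ratio: "cone_ratio h h'" "cone_ratio k k'"
    and deg: "degree h \<le> d" "degree k \<le> e" "degree h' \<le> d" "degree k' \<le> e"
    and y: "Im y > 0"
  shows "ceval (hadamard_num d e h k) y / ceval (hadamard_num d e h' k') y \<notin> \<real>\<^sub>\<le>\<^sub>0"
proof
  define c where "c = ceval (hadamard_num d e h k) y / ceval (hadamard_num d e h' k') y"
  assume "ceval (hadamard_num d e h k) y / ceval (hadamard_num d e h' k') y \<in> \<real>\<^sub>\<le>\<^sub>0"
  then have "c \<in> \<real>\<^sub>\<le>\<^sub>0" by (simp add: c_def)
  have "ceval h Y * ceval k Z \<noteq> c * (ceval h' Y * ceval k' Z)" and "ceval h' Y * ceval k' Z \<noteq> 0"
    if Y: "Im Y \<ge> 0" "Y \<notin> \<real>\<^sub>\<le>\<^sub>0" and "Y * Z = y" for Y Z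
  proof -
    have Z: "Z \<notin> \<real>\<^sub>\<le>\<^sub>0" by (rule cofactor_not_nonpos_Reals[OF Y(1)]) (use that(3) y in simp)
    note h = cone_ratioD[OF ratio(1) Y(2)] and k = cone_ratioD[OF ratio(2) Z]
    have "(ceval h Y / ceval h' Y) * (ceval k Z / ceval k' Z) \<notin> \<real>\<^sub>\<le>\<^sub>0"
      using that y h k by (intro complex_cone_mult_not_nonpos[of Y Z]) auto
    then show "ceval h Y * ceval k Z \<noteq> c * (ceval h' Y * ceval k' Z)"
      using \<open>c \<in> \<real>\<^sub>\<le>\<^sub>0\<close> h k by auto
    show "ceval h' Y * ceval k' Z \<noteq> 0" using h k by simp
  qed
  then have "ceval (hadamard_num d e h k) y \<noteq> c * ceval (hadamard_num d e h' k') y"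
    and "ceval (hadamard_num d e h' k') y \<noteq> 0"
    using hadamard_num_neq_times[OF y deg, of c] hadamard_num_neq_times[OF y deg(3,4,3,4), of 0]
    by auto
  then show False by (simp add: c_def)
qed

lemma proper_position_hadamard_num:
  assumes ratio: "cone_ratio h h'" "cone_ratio k k"
    and deg: "degree h \<le> d" "degree h' \<le> d" "degree k \<le> e"
  shows "proper_position (hadamard_num d e h' k) (hadamard_num d e h k)"
  unfolding proper_position_def Im_complex_div_ge_0[symmetric]
proof (intro allI impI)
  fix y assume y: "Im y > 0"
  define c where "c = ceval (hadamard_num d e h k) y / ceval (hadamard_num d e h' k) y"
  have "ceval (hadamard_num d e h k) y = c * ceval (hadamard_num d e h' k) y"
    using hadamard_num_ratio_not_nonpos[OF ratio deg(1,3,2,3) y] by (auto simp: c_def)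
  then obtain Y Z where Y: "Im Y \<ge> 0" "Y \<notin> \<real>\<^sub>\<le>\<^sub>0" and "Y * Z = y"
    and eq: "ceval h Y * ceval k Z = c * (ceval h' Y * ceval k Z)"
    using hadamard_num_neq_times[OF y deg(1,3,2,3), of c] by blast
  have "Z \<notin> \<real>\<^sub>\<le>\<^sub>0" by (rule cofactor_not_nonpos_Reals[OF Y(1)]) (use \<open>Y * Z = y\<close> y in simp)
  then have "c = ceval h Y / ceval h' Y"
    using eq cone_ratioD(1)[OF ratio(2), of Z] cone_ratioD(2)[OF ratio(1) Y(2)]
    by (simp add: eq_divide_eq flip: mult.assoc)
  then have "c \<in> complex_cone 0 (Arg Y)"
    using cone_ratioD(3)[OF ratio(1) Y(2)] by simp
  moreover have "0 \<le> Arg Y" using Y(1) by (simp add: Arg_less_0)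
  ultimately have "0 \<le> Im c"
    by (auto simp: mem_complex_cone_0_Arg_iff closed_segment_eq_real_ivl Arg_zero
        simp flip: Arg_less_0)
  then show "0 \<le> Im (ceval (hadamard_num d e h k) y / ceval (hadamard_num d e h' k) y)"
    by (simp only: c_def)
qed

lemma real_rooted_hadamard_num:
  assumes "cone_ratio h h" and "cone_ratio k k" and "degree h \<le> d" and "degree k \<le> e"
  shows "hadamard_num d e h k \<noteq> 0" and "real_rooted (hadamard_num d e h k)"
proof -
  have "ceval (hadamard_num d e h k) y \<noteq> 0" if "Im y > 0" for y
    using hadamard_num_ratio_not_nonpos[OF assms(1,2,3,4,3,4) that] by auto
  moreover from this[of \<i>] show "hadamard_num d e h k \<noteq> 0" by auto
  ultimately show "real_rooted (hadamard_num d e h k)" by (simp add: real_rooted_iff)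
qed

theorem interlaces_hadamard_num:
  assumes h: "nonneg_coeffs h" "nonneg_coeffs h'" "h \<noteq> 0" "h' \<noteq> 0" "interlaces h' h"
    and k: "nonneg_coeffs k" "nonneg_coeffs k'" "k \<noteq> 0" "k' \<noteq> 0" "interlaces k' k"
    and deg: "degree h \<le> d" "degree h' \<le> d" "degree k \<le> e" "degree k' \<le> e"
  shows "interlaces (hadamard_num d e h' k') (hadamard_num d e h k)"
proof (rule interlaces_trans)
  note ratio_h = cone_ratio_if_interlaces[OF h] and ratio_k = cone_ratio_if_interlaces[OF k]
  note refl = cone_ratio_self[OF ratio_h] cone_ratio_self[OF ratio_k]
  have nonneg: "nonneg_coeffs (hadamard_num d e h k)" "nonneg_coeffs (hadamard_num d e h' k)"
    "nonneg_coeffs (hadamard_num d e h' k')"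
    using h(1,2) k(1,2) by (simp_all add: nonneg_coeffs_hadamard_num)
  note lead = nonneg[THEN nonneg_coeffs_lead_coeff]
  show "0 \<le> lead_coeff (hadamard_num d e h k)" "0 \<le> lead_coeff (hadamard_num d e h' k')"
    by (fact lead)+
  show "interlaces (hadamard_num d e h' k) (hadamard_num d e h k)"
    using lead refl ratio_h deg
    by (simp add: interlaces_iff_proper_position real_rooted_hadamard_num
        proper_position_hadamard_num)
  have "proper_position (hadamard_num d e h' k') (hadamard_num d e h' k)"
    using proper_position_hadamard_num[OF ratio_k refl(2) deg(3,4,2)]
    by (simp only: hadamard_num_commute[of d e])
  then show "interlaces (hadamard_num d e h' k') (hadamard_num d e h' k)"
    using lead refl deg by (simp add: interlaces_iff_proper_position real_rooted_hadamard_num)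
  show "hadamard_num d e h' k \<noteq> 0"
    using refl deg by (intro real_rooted_hadamard_num)
  show "ceval (hadamard_num d e h k) Y / ceval (hadamard_num d e h' k') Y \<notin> \<real>\<^sub>\<le>\<^sub>0"
    if "Im Y > 0" for Y
    using ratio_h ratio_k deg that by (intro hadamard_num_ratio_not_nonpos)
qed

section \<open>Symmetric decompositions\<close>

lemma symmetric_decomposition_recip_poly:
  assumes "symmetric_decomposition d h a b"
  shows "recip_poly d h = a + b"
proof -
  have "recip_poly d ([:0, 1:] * b) = recip_poly (d - 1) b" if "b \<noteq> 0"
  proof (rule poly_eqI)
    fix n
    have "degree b < d" using assms that by (simp add: symmetric_decomposition_def)
    then show "coeff (recip_poly d ([:0, 1:] * b)) n = coeff (recip_poly (d - 1) b) n"
      by (cases "d - n") (auto simp: coeff_recip_poly coeff_eq_0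
        intro!: arg_cong[where f = "coeff b"])
  qed
  then have "recip_poly d ([:0, 1:] * b) = b"
    using assms by (cases "b = 0") (auto simp: symmetric_decomposition_def recip_poly_def)
  then show ?thesis
    using assms unfolding symmetric_decomposition_def by (metis recip_poly_add)
qed

lemma Im_ceval_add_X_mult_ge:
  assumes "proper_position b a" and "proper_position a ([:0, 1:] * b)" and "Im Y > 0"
  shows "Im Y * (cmod (ceval b Y))\<^sup>2 \<le> Im (ceval (a + [:0, 1:] * b) Y * cnj (ceval (a + b) Y))"
proof -
  define A B where "A = ceval a Y" and "B = ceval b Y"
  have "Im (ceval (a + [:0, 1:] * b) Y * cnj (ceval (a + b) Y)) =
      Im (A * cnj B) + Im (Y * B * cnj A) + Im Y * (cmod B)\<^sup>2"
    unfolding cmod_power2 by (simp add: A_def B_def algebra_simps power2_eq_square)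
  moreover have "0 \<le> Im (A * cnj B)" "0 \<le> Im (Y * B * cnj A)"
    using assms by (simp_all add: proper_position_def A_def B_def)
  ultimately show ?thesis by (simp add: B_def)
qed

lemma interlaces_add_X_mult:
  assumes nonneg: "nonneg_coeffs a" "nonneg_coeffs b" and il: "interlaces b a"
    and h: "h = a + [:0, 1:] * b" and g: "g = a + b"
  shows "nonneg_coeffs h" and "interlaces g h"
proof -
  show nonneg_h: "nonneg_coeffs h"
    unfolding h using nonneg by (simp add: nonneg_coeffs_add nonneg_coeffs_pCons)
  have "nonneg_coeffs g"
    unfolding g using nonneg by (rule nonneg_coeffs_add)
  note lead = nonneg[THEN nonneg_coeffs_lead_coeff] nonneg_h[THEN nonneg_coeffs_lead_coeff]
    this[THEN nonneg_coeffs_lead_coeff]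
  have rr: "real_rooted a" "real_rooted b" and pp: "proper_position b a"
    using il lead by (simp_all add: interlaces_iff_proper_position)
  show "interlaces g h"
  proof (cases "b = 0")
    case True
    then show ?thesis
      using rr lead by (simp add: h g interlaces_iff_proper_position proper_position_def)
  next
    case False
    have "proper_position a ([:0, 1:] * b)"
      using interlaces_X_mult[OF nonneg il] lead by (simp add: interlaces_iff_proper_position)
    have pos: "0 < Im (ceval h Y * cnj (ceval g Y))" if Y: "Im Y > 0" for Y
    proof -
      have "ceval b Y \<noteq> 0" using rr(2) False Y by (simp add: real_rooted_iff)
      then have "0 < Im Y * (cmod (ceval b Y))\<^sup>2" using Y by simp
      also have "\<dots> \<le> Im (ceval h Y * cnj (ceval g Y))"
        unfolding h g using pp \<open>proper_position a _\<close> Y by (rule Im_ceval_add_X_mult_ge)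
      finally show ?thesis .
    qed
    have nz: "ceval h Y \<noteq> 0" "ceval g Y \<noteq> 0" if "Im Y > 0" for Y
      using pos[OF that] by auto
    have "h \<noteq> 0" "g \<noteq> 0" using nz[of \<i>] by auto
    with nz have "real_rooted h" "real_rooted g" by (simp_all add: real_rooted_iff)
    moreover have "proper_position g h"
      using pos by (auto simp: proper_position_def intro: less_imp_le)
    ultimately show ?thesis using lead by (simp add: interlaces_iff_proper_position)
  qed
qed

lemma interlaces_add_X_multD:
  assumes nonneg: "nonneg_coeffs h" "nonneg_coeffs g" and il: "interlaces g h"
    and h: "h = a + [:0, 1:] * b" and g: "g = a + b"
  shows "nonneg_coeffs a" and "nonneg_coeffs b" and "interlaces b a"
proof -
  have "h - g = [:- 1, 1:] * b" by (simp add: h g)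
  note b = interlaces_diff_quotient[OF nonneg il _ this, simplified]
  have "nonneg_coeffs ([:0, 1:] * g)"
    using nonneg(2) by (simp add: nonneg_coeffs_pCons)
  moreover have "[:0, 1:] * g - h = [:- 1, 1:] * a" by (simp add: h g algebra_simps)
  ultimately have a: "nonneg_coeffs a" "interlaces a h"
    using interlaces_diff_quotient[OF _ nonneg(1), of "[:0, 1:] * g" 1 a]
      interlaces_X_mult[OF nonneg il] by simp_all
  have "proper_position b g"
    using b(2) interlaces_iff_proper_position nonneg(2) b(1) nonneg_coeffs_lead_coeff by blast
  then have "proper_position b a" by (simp only: g proper_position_add_self_iff)
  moreover have "real_rooted a" "real_rooted b"
    using a(2) b(2) by (simp_all add: interlaces_iff_interlacing)
  ultimately show "interlaces b a"
    using a(1) b(1) by (simp add: interlaces_iff_proper_position nonneg_coeffs_lead_coeff)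
  show "nonneg_coeffs a" "nonneg_coeffs b" by fact+
qed

theorem nonneg_interlacing_decomposition_iff:
  assumes "degree h \<le> d"
  shows "nonneg_interlacing_decomposition d h \<longleftrightarrow>
    nonneg_coeffs h \<and> interlaces (recip_poly d h) h"
proof -
  obtain a b where ab: "symmetric_decomposition d h a b"
    using symmetric_decomposition_exists[OF assms] by blast
  have h: "h = a + [:0, 1:] * b" using ab by (simp add: symmetric_decomposition_def)
  have recip: "recip_poly d h = a + b" using ab by (rule symmetric_decomposition_recip_poly)
  have "nonneg_interlacing_decomposition d h \<longleftrightarrow>
      nonneg_coeffs a \<and> nonneg_coeffs b \<and> interlaces b a"
    unfolding nonneg_interlacing_decomposition_def
    using ab symmetric_decomposition_unique[OF ab] by blast
  also have "\<dots> \<longleftrightarrow> nonneg_coeffs h \<and> interlaces (recip_poly d h) h"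
    using interlaces_add_X_mult[OF _ _ _ h recip] interlaces_add_X_multD[OF _ _ _ h recip]
      nonneg_coeffs_recip_poly by blast
  finally show ?thesis .
qed

lemma recip_poly_eq_0_iff:
  assumes "degree a \<le> d"
  shows "recip_poly d a = 0 \<longleftrightarrow> a = 0"
proof
  assume "recip_poly d a = 0"
  then have "coeff (recip_poly d a) (d - degree a) = 0" by simp
  then show "a = 0" using assms by (simp add: coeff_recip_poly)
qed (simp add: recip_poly_def)

theorem theorem1p5:
  fixes p q :: "real poly"
  assumes "nonneg_interlacing_decomposition (degree p) (W_poly p)"
    and "nonneg_interlacing_decomposition (degree q) (W_poly q)"
  shows "nonneg_interlacing_decomposition (degree (p * q)) (W_poly (p * q))"
proof (cases "p = 0 \<or> q = 0")
  case True
  then show ?thesis using assms by auto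
next
  case False
  define h k where "h = W_poly p" and "k = W_poly q"
  have deg: "degree h \<le> degree p" "degree k \<le> degree q"
    by (simp_all add: h_def k_def degree_W_poly)
  have nz: "h \<noteq> 0" "k \<noteq> 0"
    using False by (simp_all add: h_def k_def W_poly_eq_0_iff)
  have nonneg: "nonneg_coeffs h" "nonneg_coeffs k"
    and il: "interlaces (recip_poly (degree p) h) h" "interlaces (recip_poly (degree q) k) k"
    using assms deg by (simp_all add: nonneg_interlacing_decomposition_iff flip: h_def k_def)
  let ?\<Theta> = "hadamard_num (degree p) (degree q)"
  have "interlaces (?\<Theta> (recip_poly (degree p) h) (recip_poly (degree q) k)) (?\<Theta> h k)"
    using deg nz nonneg il
    by (intro interlaces_hadamard_num)
      (simp_all add: nonneg_coeffs_recip_poly recip_poly_eq_0_iff degree_recip_poly)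
  then have "nonneg_interlacing_decomposition (degree p + degree q) (?\<Theta> h k)"
    using nonneg by (simp add: nonneg_interlacing_decomposition_iff degree_hadamard_num
        nonneg_coeffs_hadamard_num recip_poly_hadamard_num)
  then show ?thesis
    using False by (simp add: W_poly_mult degree_mult_eq h_def k_def)
qed

end
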